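(* Let $p_1,\ldots,p_n\in\mathbb B$ be $n$ distinct points, let $s_1,\ldots,s_n\in\mathbb H$, and assume that the Pick matrix $$P=\left[\sum_{k=0}^\infty p_i^k(1-s_i\bar s_j)\bar p_j^k\right]_{i,j=1}^n$$ is positive definite. Let $T=\mathrm{diag}(p_1,\ldots,p_n)$, let $E=[1\ \cdots\ 1]^\top\in\mathbb H^n$ and $N=[s_1\ \cdots\ s_n]^\top\in\mathbb H^n$ (columns), and let $$\Theta(p)=\begin{bmatrix}\Theta_{11}(p)&\Theta_{12}(p)\\ \Theta_{21}(p)&\Theta_{22}(p)\end{bmatrix}=\mathbf I_2+(p-1)\sum_{k=0}^\infty p^k\begin{bmatrix}E^*\\ N^*\end{bmatrix}T^{*k}P^{-1}(\mathbf I_n-T)^{-1}\begin{bmatrix}E&-N\end{bmatrix}\qquad(p\in\mathbb B).$$ Then all functions $S\in\mathcal R(\mathbb B,\overline{\mathbb B})$ satisfying $S(p_i)=s_i$ for $i=1,\ldots,n$ are given by the formula $$S=(\Theta_{11}\star\mathcal E+\Theta_{12})\star(\Theta_{21}\star\mathcal E+\Theta_{22})^{-\star}$$ with the free parameter $\mathcal E$ running through the class $\mathcal R(\mathbb B,\overline{\mathbb B})$; that is, a function $S$ on $\mathbb B$ is a solution of this interpolation problem if and only if it is of this form for some $\mathcal E\in\mathcal R(\mathbb B,\overline{\mathbb B})$.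
   Context: $\mathbb H$ is the algebra of real quaternions, $\mathbb B=\{p\in\mathbb H:|p|<1\}$, $\overline{\mathbb B}$ its closure, and $\mathbb S$ is the unit sphere of purely imaginary quaternions; for $I\in\mathbb S$, $\mathbb C_I=\{x+Iy:x,y\in\mathbb R\}$. For $\Omega\subset\mathbb H$ open, a real differentiable function $f:\Omega\to\mathbb H$ is (left) slice regular on $\Omega$ if for every $I\in\mathbb S$ its restriction $f_I$ to $\Omega\cap\mathbb C_I$ satisfies $\frac{\partial}{\partial x}f_I(x+Iy)+I\frac{\partial}{\partial y}f_I(x+Iy)\equiv0$. The set $\mathcal R(\mathbb B)$ of functions slice regular on $\mathbb B$ is exactly the set of power series $f(p)=\sum_{k\ge0}p^kf_k$, $f_k\in\mathbb H$, with radius of convergence at least one. $\mathcal R(\mathbb B,\overline{\mathbb B})$ is the set of $f\in\mathcal R(\mathbb B)$ with $|f(p)|\le1$ for all $p\in\mathbb B$. The $\star$-product of $g(p)=\sum p^kg_k$ and $f(p)=\sum p^kf_k$ is $(g\star f)(p)=\sum_kp^k\bigl(\sum_{r=0}^kg_rf_{k-r}\bigr)$. The $\star$-inverse $f^{-\star}$ of $f\in\mathcal R(\mathbb B)$ is characterized by $f\star f^{-\star}=f^{-\star}\star f\equiv1$; explicitly $f^{-\star}(p)=\bigl((f^c\star f)(p)\bigr)^{-1}f^c(p)$ where $f^c(p)=\sum_kp^k\overline{f_k}$, defined on $\mathbb B$ outside the zeros of $f^c\star f$, and it belongs to $\mathcal R(\mathbb B)$ if $f$ has no zeros in $\mathbb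 B$. For quaternionic matrices $A^*$ denotes the conjugate transpose, and a Hermitian matrix $A$ is positive definite if $c^*Ac>0$ for all nonzero column vectors $c$ over $\mathbb H$. $\mathbf I_m$ is the $m\times m$ identity matrix. *)

theory Defs
  imports "HOL-Analysis.Analysis"
begin

section \<open>The algebra of real quaternions\<close>

codatatype quat = Quat (q_re: real) (q_i: real) (q_j: real) (q_k: real)

lemma quat_eq_iff: "x = y \<longleftrightarrow> q_re x = q_re y \<and> q_i x = q_i y \<and> q_j x = q_j y \<and> q_k x = q_k y"
  by (auto intro: quat.expand)

instantiation quat :: ab_group_add
begin

primcorec zero_quat where
  "q_re 0 = 0" | "q_i 0 = 0" | "q_j 0 = 0" | "q_k 0 = 0"

primcorec plus_quat where
  "q_re (x + y) = q_re x + q_re y"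
| "q_i (x + y) = q_i x + q_i y"
| "q_j (x + y) = q_j x + q_j y"
| "q_k (x + y) = q_k x + q_k y"

primcorec uminus_quat where
  "q_re (- x) = - q_re x"
| "q_i (- x) = - q_i x"
| "q_j (- x) = - q_j x"
| "q_k (- x) = - q_k x"

primcorec minus_quat where
  "q_re (x - y) = q_re x - q_re y"
| "q_i (x - y) = q_i x - q_i y"
| "q_j (x - y) = q_j x - q_j y"
| "q_k (x - y) = q_k x - q_k y"

instance
  by standard (simp_all add: quat_eq_iff)

end

text \<open>Hamilton product: $i^2 = j^2 = k^2 = ijk = -1$.\<close>

instantiation quat :: ring_1
begin

primcorec one_quat where
  "q_re 1 = 1" | "q_i 1 = 0" | "q_j 1 = 0" | "q_k 1 = 0"

primcorec times_quat where
  "q_re (x * y) = q_re x * q_re y - q_i x * q_i y - q_j x * q_j y - q_k x * q_k y"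
| "q_i (x * y) = q_re x * q_i y + q_i x * q_re y + q_j x * q_k y - q_k x * q_j y"
| "q_j (x * y) = q_re x * q_j y - q_i x * q_k y + q_j x * q_re y + q_k x * q_i y"
| "q_k (x * y) = q_re x * q_k y + q_i x * q_j y - q_j x * q_i y + q_k x * q_re y"

instance
  by standard (simp_all add: quat_eq_iff algebra_simps)

end

instantiation quat :: real_algebra_1
begin

primcorec scaleR_quat where
  "q_re (scaleR r x) = r * q_re x"
| "q_i (scaleR r x) = r * q_i x"
| "q_j (scaleR r x) = r * q_j x"
| "q_k (scaleR r x) = r * q_k x"

instance
  by standard (simp_all add: quat_eq_iff algebra_simps)

end

primcorec qcnj :: "quat \<Rightarrow> quat" where
  "q_re (qcnj x) = q_re x"
| "q_i (qcnj x) = - q_i x"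
| "q_j (qcnj x) = - q_j x"
| "q_k (qcnj x) = - q_k x"

instantiation quat :: real_inner
begin

definition inner_quat_def:
  "inner x y = q_re x * q_re y + q_i x * q_i y + q_j x * q_j y + q_k x * q_k y"

definition norm_quat_def:
  "norm x = sqrt ((q_re x)\<^sup>2 + (q_i x)\<^sup>2 + (q_j x)\<^sup>2 + (q_k x)\<^sup>2)"

definition sgn_quat_def: "sgn (x::quat) = x /\<^sub>R norm x"

definition dist_quat_def: "dist x (y::quat) = norm (x - y)"

definition uniformity_quat_def [code del]:
  "(uniformity :: (quat \<times> quat) filter) = (INF e\<in>{0 <..}. principal {(x, y). dist x y < e})"

definition open_quat_def [code del]:
  "open (U :: quat set) \<longleftrightarrow> (\<forall>x\<in>U. eventually (\<lambda>(x', y). x' = x \<longrightarrow> y \<in> U) uniformity)"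

instance
proof
  fix r :: real and x y z :: quat
  show "inner x y = inner y x"
    by (simp add: inner_quat_def mult.commute)
  show "inner (x + y) z = inner x z + inner y z"
    by (simp add: inner_quat_def distrib_right)
  show "inner (r *\<^sub>R x) y = r * inner x y"
    by (simp add: inner_quat_def distrib_left mult.assoc)
  show "0 \<le> inner x x"
    by (simp add: inner_quat_def)
  show "inner x x = 0 \<longleftrightarrow> x = 0"
    by (simp add: inner_quat_def quat_eq_iff add_nonneg_eq_0_iff)
  show "norm x = sqrt (inner x x)"
    by (simp add: norm_quat_def inner_quat_def power2_eq_square)
qed (rule sgn_quat_def dist_quat_def uniformity_quat_def open_quat_def)+

end

lemma norm_quat_mult: "norm (x * y) = norm x * norm (y::quat)"
proof -
  have "(a*e - b*f - c*g - d*h)\<^sup>2 + (a*f + b*e + c*h - d*g)\<^sup>2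
          + (a*g - b*h + c*e + d*f)\<^sup>2 + (a*h + b*g - c*f + d*e)\<^sup>2
        = (a\<^sup>2 + b\<^sup>2 + c\<^sup>2 + d\<^sup>2) * (e\<^sup>2 + f\<^sup>2 + g\<^sup>2 + h\<^sup>2)"
    for a b c d e f g h :: real
    by algebra
  then show ?thesis
    by (simp only: norm_quat_def times_quat.simps real_sqrt_mult)
qed

lemma qcnj_mult_self: "qcnj x * x = of_real ((norm x)\<^sup>2)" "x * qcnj x = of_real ((norm x)\<^sup>2)"
  by (simp_all add: quat_eq_iff of_real_def norm_quat_def power2_eq_square)

instantiation quat :: real_normed_div_algebra
begin

definition inverse_quat_def: "inverse x = qcnj x /\<^sub>R (norm x)\<^sup>2"

definition divide_quat_def: "x div y = x * inverse (y::quat)"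

instance
proof
  fix x y :: quat
  show "x \<noteq> 0 \<Longrightarrow> inverse x * x = 1" "x \<noteq> 0 \<Longrightarrow> x * inverse x = 1"
    by (simp_all add: inverse_quat_def qcnj_mult_self of_real_def)
  show "inverse (0::quat) = 0"
    by (simp add: inverse_quat_def)
  show "x div y = x * inverse y"
    by (rule divide_quat_def)
  show "norm (x * y) = norm x * norm y"
    by (rule norm_quat_mult)
qed

end

instantiation quat :: euclidean_space
begin

definition Basis_quat_def: "Basis = {Quat 1 0 0 0, Quat 0 1 0 0, Quat 0 0 1 0, Quat 0 0 0 1}"

instance
proof
  show "(Basis :: quat set) \<noteq> {}" "finite (Basis :: quat set)"
    by (simp_all add: Basis_quat_def)
  show "inner u v = (if u = v then 1 else 0)" if "u \<in> Basis" "v \<in> Basis" for u v :: quat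
    using that unfolding Basis_quat_def by (elim insertE emptyE) (simp_all add: inner_quat_def)
  show "(\<forall>u\<in>Basis. inner x u = 0) \<longleftrightarrow> x = 0" for x :: quat
    by (simp add: Basis_quat_def inner_quat_def quat_eq_iff [of x 0])
qed

end


section \<open>Slice regular functions\<close>

definition imag_sphere :: "quat set" where
  "imag_sphere = {u. q_re u = 0 \<and> norm u = 1}"

definition slice_regular_on :: "quat set \<Rightarrow> (quat \<Rightarrow> quat) \<Rightarrow> bool" where
  "slice_regular_on \<Omega> f \<longleftrightarrow>
     open \<Omega> \<and> f differentiable_on \<Omega> \<and>
     (\<forall>u\<in>imag_sphere. \<forall>x y. of_real x + u * of_real y \<in> \<Omega> \<longrightarrow>
        vector_derivative (\<lambda>t. f (of_real t + u * of_real y)) (at x)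
        + u * vector_derivative (\<lambda>t. f (of_real x + u * of_real t)) (at y) = 0)"

text \<open>
  Functions on the open unit ball are represented by total functions; their values outside
  the ball are irrelevant.
\<close>

definition slice_regular_ball :: "(quat \<Rightarrow> quat) set" where
  "slice_regular_ball = {f. slice_regular_on (ball 0 1) f}"

definition slice_schur :: "(quat \<Rightarrow> quat) set" where
  "slice_schur = {f \<in> slice_regular_ball. \<forall>q\<in>ball 0 1. norm (f q) \<le> 1}"

text \<open>
  The coefficients $f_k$ in $f(q) = \sum_k q^k f_k$; meaningful for \<^term>\<open>f \<in> slice_regular_ball\<close>.
\<close>

definition ps_coeff :: "(quat \<Rightarrow> quat) \<Rightarrow> nat \<Rightarrow> quat" where
  "ps_coeff f = (THE a. \<forall>q\<in>ball 0 1. (\<lambda>k. q ^ k * a k) sums f q)"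

lemma real_powser_unique:
  fixes d :: "nat \<Rightarrow> real"
  assumes "\<And>x. norm x < 1 \<Longrightarrow> (\<lambda>k. d k * x ^ k) sums 0"
  shows "d n = 0"
proof (induction n rule: less_induct)
  case (less n)
  have "(\<lambda>k. d (k + n) * x ^ k) sums 0" if "x \<noteq> 0" "norm x < 1" for x
  proof -
    have "(\<lambda>k. d (k + n) * x ^ (k + n)) sums (0 - (\<Sum>k<n. d k * x ^ k))"
      using assms[OF that(2)] by (subst sums_iff_shift) simp
    then have "(\<lambda>k. d (k + n) * x ^ k * x ^ n) sums 0"
      by (simp add: less.IH power_add mult.assoc)
    then show ?thesis
      using sums_mult2_iff [of "x ^ n" "\<lambda>k. d (k + n) * x ^ k" 0] that(1) by simp
  qed
  then have "((\<lambda>x::real. 0::real) \<longlongrightarrow> d (0 + n)) (at 0)"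
    by (intro powser_limit_0_strong [of 1 "\<lambda>k. d (k + n)" "\<lambda>x. 0"]) auto
  then show ?case
    by (simp add: tendsto_const_iff)
qed

lemma ps_coeff_eqI:
  assumes a: "\<And>q. q \<in> ball 0 1 \<Longrightarrow> (\<lambda>k. q ^ k * a k) sums f q"
  shows "ps_coeff f = a"
  unfolding ps_coeff_def
proof (rule the_equality)
  show "\<forall>q\<in>ball 0 1. (\<lambda>k. q ^ k * a k) sums f q"
    using a by blast
next
  fix b assume b: "\<forall>q\<in>ball 0 1. (\<lambda>k. q ^ k * b k) sums f q"
  have "(b k - a k) \<bullet> e = 0" for e k
  proof (rule real_powser_unique)
    fix x :: real assume x: "norm x < 1"
    have "(\<lambda>k. of_real x ^ k * b k - of_real x ^ k * a k) sums (f (of_real x) - f (of_real x))"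
      using a[of "of_real x"] b x by (intro sums_diff) auto
    then have "(\<lambda>k. (of_real x ^ k * b k - of_real x ^ k * a k) \<bullet> e) sums (0 \<bullet> e)"
      using bounded_linear.sums [OF bounded_linear_inner_left] by fastforce
    moreover have "(of_real x ^ k * b k - of_real x ^ k * a k) \<bullet> e = ((b k - a k) \<bullet> e) * x ^ k" for k
      by (simp add: scaleR_conv_of_real [symmetric] of_real_power [symmetric]
          right_diff_distrib [symmetric] scaleR_diff_right [symmetric] del: of_real_power)
    ultimately show "(\<lambda>k. ((b k - a k) \<bullet> e) * x ^ k) sums 0"
      by simp
  qed
  then show "b = a"
    by (metis ext eq_iff_diff_eq_0 inner_eq_zero_iff)
qed

definition star_prod :: "(quat \<Rightarrow> quat) \<Rightarrow> (quat \<Rightarrow> quat) \<Rightarrow> quat \<Rightarrow> quat"  (infixl \<open>\<star>\<close> 70) where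
  "(g \<star> f) q = (\<Sum>k. q ^ k * (\<Sum>r\<le>k. ps_coeff g r * ps_coeff f (k - r)))"

definition star_conj :: "(quat \<Rightarrow> quat) \<Rightarrow> quat \<Rightarrow> quat" where
  "star_conj f q = (\<Sum>k. q ^ k * qcnj (ps_coeff f k))"

definition star_inv_defined_at :: "(quat \<Rightarrow> quat) \<Rightarrow> quat \<Rightarrow> bool" where
  "star_inv_defined_at f q \<longleftrightarrow> (star_conj f \<star> f) q \<noteq> 0"

text \<open>
  At a point where \<^term>\<open>star_inv_defined_at f q\<close> fails, the value is the default
  \<^term>\<open>inverse 0 = (0::quat)\<close>.
\<close>

definition star_inv :: "(quat \<Rightarrow> quat) \<Rightarrow> quat \<Rightarrow> quat" where
  "star_inv f q = inverse ((star_conj f \<star> f) q) * star_conj f q"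


section \<open>Quaternionic matrices\<close>

definition ctranspose :: "quat ^ 'n ^ 'm \<Rightarrow> quat ^ 'm ^ 'n" where
  "ctranspose A = (\<chi> i j. qcnj (A $ j $ i))"

text \<open>The quadratic form $c^* A c$ has to be a positive real number.\<close>

definition pos_definite :: "quat ^ 'n ^ 'n \<Rightarrow> bool" where
  "pos_definite A \<longleftrightarrow> ctranspose A = A \<and>
     (\<forall>c::quat ^ 'n. c \<noteq> 0 \<longrightarrow>
        (\<exists>r::real. r > 0 \<and> (\<Sum>i\<in>UNIV. qcnj (c $ i) * (A *v c) $ i) = of_real r))"

definition lscale :: "quat \<Rightarrow> quat ^ 'n ^ 'm \<Rightarrow> quat ^ 'n ^ 'm" where
  "lscale c A = (\<chi> i j. c * A $ i $ j)"

text \<open>Powers for the product \<open>**\<close>; the library's \<open>^\<close> on vectors is componentwise.\<close>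

primrec mat_pow :: "quat ^ 'n ^ 'n \<Rightarrow> nat \<Rightarrow> quat ^ 'n ^ 'n" where
  "mat_pow A 0 = mat 1"
| "mat_pow A (Suc k) = A ** mat_pow A k"

definition diag_mat :: "('n \<Rightarrow> quat) \<Rightarrow> quat ^ 'n ^ 'n" where
  "diag_mat d = (\<chi> i j. if i = j then d i else 0)"

text \<open>The $n \times 2$ matrix with columns $u$ and $v$.\<close>

definition two_cols :: "quat ^ 'n \<Rightarrow> quat ^ 'n \<Rightarrow> quat ^ 2 ^ 'n" where
  "two_cols u v = transpose (vector [u, v])"


section \<open>Pick matrix and resolvent matrix\<close>

definition pick_matrix :: "('n \<Rightarrow> quat) \<Rightarrow> ('n \<Rightarrow> quat) \<Rightarrow> quat ^ 'n ^ 'n" where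
  "pick_matrix p s = (\<chi> i j. \<Sum>k. p i ^ k * (1 - s i * qcnj (s j)) * qcnj (p j) ^ k)"

text \<open>\<^term>\<open>ctranspose (two_cols E N)\<close> is the $2 \times n$ matrix with rows $E^*$ and $N^*$.\<close>

definition Theta :: "('n::finite \<Rightarrow> quat) \<Rightarrow> ('n \<Rightarrow> quat) \<Rightarrow> quat \<Rightarrow> quat ^ 2 ^ 2" where
  "Theta p s q =
    (let T = diag_mat p; E = (\<chi> i. 1); N = (\<chi> i. s i); P = pick_matrix p s
     in mat 1 + lscale (q - 1)
          (\<Sum>k. lscale (q ^ k)
             (ctranspose (two_cols E N) ** mat_pow (ctranspose T) k ** matrix_inv P
              ** matrix_inv (mat 1 - T) ** two_cols E (- N))))"

end

theory Submission
  imports Defs "HOL-Complex_Analysis.Conformal_Mappings" "HOL-Computational_Algebra.Formal_Power_Series"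
begin

text \<open>
  A slice regular function on the ball is a power series, and it is bounded by $1$ iff star
  multiplication by it is a contraction on every initial segment of coefficient sequences; so
  everything can be phrased with formal power series over the quaternions.

  The resolvent matrix is the transfer function of a linear system with state $x_k$ in
  $\mathbb H^n$ for which the Stein equation $P - TPT^* = EE^* - NN^*$ yields the energy balance
  $x_{k+1}^* P x_{k+1} + |y_1|^2 - |y_2|^2 = x_k^* P x_k + |u_1|^2 - |u_2|^2$ and the backward
  recursion $P x_k = T P x_{k+1} + E y_1 - N y_2$. Feeding in $u = (\mathcal E \star h, h)$ with
  $\mathcal E$ a Schur function, the balance shows that the numerator is dominated by the
  denominator and that the states stay bounded; hence the denominator is invertible on the ball,
  the quotient is a Schur function, and the backward recursion started at $x_0 = 0$ is the
  interpolation condition. Conversely, an interpolating Schur function $S$ lets one solve the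
  backward recursion for the output $(S, 1)$; the energy of each state is at most the energy
  dissipated by $S$ so far, so the input $(u_1, u_2)$ recovered from the states satisfies
  $|u_1 \star g| \le |u_2 \star g|$ on initial segments, and $\mathcal E = u_1 \star u_2^{-\star}$.
\<close>

text \<open>Values do not multiply: (f \<star> g)(q) is the sum of q^k f(q) g_k, with f(q) caught
  between the powers and the coefficients of g. So a bound on a star quotient cannot be read off
  pointwise from numerator and denominator. Truncated coefficient sums avoid evaluation, and since
  star multiplication is causal they make sense for series of which no convergence is known. This
  matters for the inverse of the denominator: it first exists only formally, thanks to its constant
  coefficient, and it converges because the states stay bounded. The factor p - 1 and the inverse of
  I - T normalize the resolvent matrix to the identity at p = 1. In the system they appear through a
  vector b with (I - T) P b = E u_1 - N u_2: the state is x = b + d with d = (p - 1) \<Sum> p^k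
  T^{*k} b. Then x_k - x_{k+1} = d_k - T^* d_k, so the inputs can be recovered from the outputs and
  two consecutive states.\<close>

lemma q_re_mult_commute: "q_re (x * y) = q_re (y * x)"
  by simp

lemma inner_quat_eq: "inner x y = q_re (qcnj x * y)"
  by (simp add: inner_quat_def)

lemma qcnj_mult [simp]: "qcnj (x * y) = qcnj y * qcnj x"
  by (simp add: quat_eq_iff algebra_simps)

lemma qcnj_add [simp]: "qcnj (x + y) = qcnj x + qcnj y"
  and qcnj_diff [simp]: "qcnj (x - y) = qcnj x - qcnj y"
  and qcnj_1 [simp]: "qcnj 1 = 1"
  and qcnj_qcnj [simp]: "qcnj (qcnj x) = x"
  and qcnj_of_real [simp]: "qcnj (of_real r) = of_real r"
  by (simp_all add: quat_eq_iff of_real_def)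

lemma norm_qcnj [simp]: "norm (qcnj x) = norm x"
  by (simp add: norm_quat_def)

lemma qcnj_eq_0_iff [simp]: "qcnj x = 0 \<longleftrightarrow> x = 0"
  by (metis norm_eq_zero norm_qcnj)

lemma qcnj_power [simp]: "qcnj (x ^ n) = qcnj x ^ n"
  by (induction n) (simp_all add: power_commutes)

lemma qcnj_sum: "qcnj (sum f A) = (\<Sum>x\<in>A. qcnj (f x))"
  by (induction A rule: infinite_finite_induct) simp_all

lemma inner_quat_mult_left: "inner (c * x) y = inner x (qcnj c * (y::quat))"
  by (simp add: inner_quat_def algebra_simps)

lemma inner_quat_mult_right: "inner (x * c) y = inner x (y * qcnj (c::quat))"
  by (simp add: inner_quat_def algebra_simps)

lemma of_real_quat_commute: "of_real r * (x::quat) = x * of_real r"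
  by (simp add: of_real_def)

lemma q_re_of_real [simp]: "q_re (of_real r) = r"
  by (simp add: of_real_def)

subsection \<open>Slices\<close>

lemma imag_sphere_square: "u \<in> imag_sphere \<Longrightarrow> u * u = - 1"
  using qcnj_mult_self(1)[of u]
  by (auto simp: imag_sphere_def quat_eq_iff)

lemma imag_sphere_qcnj: "u \<in> imag_sphere \<Longrightarrow> qcnj u = - u"
  by (auto simp: imag_sphere_def quat_eq_iff)

lemma imag_sphere_conjugate:
  assumes "u \<in> imag_sphere" "c \<noteq> 0"
  shows "c * u * inverse c \<in> imag_sphere"
proof -
  have "q_re (c * u * inverse c) = q_re (inverse c * (c * u))"
    by (rule q_re_mult_commute)
  also have "\<dots> = q_re u"
    using assms by (simp add: mult.assoc[symmetric])
  finally show ?thesis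
    using assms by (simp add: imag_sphere_def norm_mult norm_inverse del: times_quat.simps)
qed

text \<open>For u in \<open>imag_sphere\<close> this is the isometric field embedding of the complex
  numbers onto C_u, which makes complex analysis available on each slice.\<close>

definition slice_embed :: "quat \<Rightarrow> complex \<Rightarrow> quat" where
  "slice_embed u z = of_real (Re z) + u * of_real (Im z)"

lemma slice_embed_add: "slice_embed u (z + w) = slice_embed u z + slice_embed u w"
  and slice_embed_of_real [simp]: "slice_embed u (of_real r) = of_real r"
  and slice_embed_0 [simp]: "slice_embed u 0 = 0"
  and slice_embed_1 [simp]: "slice_embed u 1 = 1"
  by (simp_all add: slice_embed_def algebra_simps)

lemma slice_embed_mult:
  assumes "u \<in> imag_sphere"
  shows "slice_embed u (z * w) = slice_embed u z * slice_embed u w"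
proof -
  have "slice_embed u z * slice_embed u w =
      of_real (Re z * Re w) + u * of_real (Re z * Im w + Im z * Re w) + (u * u) * of_real (Im z * Im w)"
    by (simp add: slice_embed_def of_real_def algebra_simps)
  then show ?thesis
    by (simp add: imag_sphere_square[OF assms]) (simp add: slice_embed_def)
qed

lemma slice_embed_power:
  "u \<in> imag_sphere \<Longrightarrow> slice_embed u (z ^ n) = slice_embed u z ^ n"
  by (induction n) (simp_all add: slice_embed_mult)

lemma norm_slice_embed [simp]:
  assumes "u \<in> imag_sphere"
  shows "norm (slice_embed u z) = norm z"
proof -
  have "qcnj (slice_embed u z) * slice_embed u z = slice_embed u (cnj z * z)"
    unfolding slice_embed_mult[OF assms]
    by (simp add: slice_embed_def imag_sphere_qcnj[OF assms] of_real_quat_commute)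
  also have "cnj z * z = of_real ((norm z)\<^sup>2)"
    by (simp add: complex_norm_square mult.commute del: of_real_power)
  finally have "(norm (slice_embed u z))\<^sup>2 = (norm z)\<^sup>2"
    unfolding qcnj_mult_self slice_embed_of_real of_real_eq_iff .
  then show ?thesis
    by simp
qed

lemma slice_embed_surj:
  obtains u z where "u \<in> imag_sphere" "q = slice_embed u z"
proof (cases "q = of_real (q_re q)")
  case True
  \<comment> \<open>Real quaternions lie in every slice, so any imaginary unit will do.\<close>
  have "Quat 0 1 0 0 \<in> imag_sphere"
    by (simp add: imag_sphere_def norm_quat_def)
  with True show ?thesis
    by (intro that[of "Quat 0 1 0 0" "of_real (q_re q)"]) simp_all
next
  case False
  define v where "v = q - of_real (q_re q)"
  have v: "v \<noteq> 0" "q_re v = 0"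
    using False by (simp_all add: v_def)
  show ?thesis
  proof (rule that)
    show "v /\<^sub>R norm v \<in> imag_sphere"
      using v by (simp add: imag_sphere_def)
    show "q = slice_embed (v /\<^sub>R norm v) (Complex (q_re q) (norm v))"
      using v by (simp add: slice_embed_def of_real_def) (simp add: v_def of_real_def)
  qed
qed

text \<open>Coordinate of $q$ along $\mathbb C_u$ in the left vector space $\mathbb H$ over $\mathbb C_u$.\<close>

definition slice_proj :: "quat \<Rightarrow> quat \<Rightarrow> complex" where
  "slice_proj u q = Complex (q_re q) (inner q u)"

lemma bounded_linear_slice_proj: "bounded_linear (slice_proj u)"
proof -
  have "bounded_linear (\<lambda>q. of_real (inner q 1) + \<i> * of_real (inner q u))"
    by (intro bounded_linear_add bounded_linear_const_mult bounded_linear_compose[OF bounded_linear_of_real]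
        bounded_linear_inner_left)
  also have "(\<lambda>q. of_real (inner q 1) + \<i> * of_real (inner q u)) = slice_proj u"
    by (auto simp: slice_proj_def inner_quat_def complex_eq_iff)
  finally show ?thesis .
qed

lemma slice_proj_slice_embed_mult:
  assumes "u \<in> imag_sphere"
  shows "slice_proj u (slice_embed u z * q) = z * slice_proj u q"
proof -
  have u: "q_re u = 0" "q_i u * q_i u + q_j u * q_j u + q_k u * q_k u = 1"
    using imag_sphere_square[OF assms] assms by (auto simp: imag_sphere_def quat_eq_iff)
  have "q_re (u * q) = - inner q u"
    using u by (simp add: inner_quat_def)
  moreover have "inner (u * q) u = q_re q"
    using imag_sphere_square[OF assms]
    by (simp add: inner_quat_mult_left imag_sphere_qcnj[OF assms]) (simp add: inner_quat_def)
  ultimately show ?thesis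
    by (simp add: slice_proj_def slice_embed_def complex_eq_iff distrib_right inner_add_left of_real_def
        del: times_quat.simps)
qed

text \<open>Testing w = \<open>qcnj q\<close> puts |q|^2 into the real part. Identities between
  quaternions thus reduce to complex-valued functions, provided that all right multiples are
  covered.\<close>

lemma slice_proj_zero_imp:
  assumes "\<And>w. slice_proj u (q * w) = 0"
  shows "q = 0"
proof -
  have "q_re (q * qcnj q) = 0"
    using assms[of "qcnj q"] by (simp add: slice_proj_def complex_eq_iff del: times_quat.simps)
  then show ?thesis
    by (simp add: qcnj_mult_self(2) del: times_quat.simps of_real_power)
qed

text \<open>H is C_u + C_u v. If q = a + b v, then q v = a v - b because v^2 = -1, and a v is
  orthogonal to C_u; so b is minus the projection of q v.\<close>

lemma slice_decomp:
  defines "u \<equiv> Quat 0 1 0 0" and "v \<equiv> Quat 0 0 1 0"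
  shows "q = slice_embed u (slice_proj u q) - slice_embed u (slice_proj u (q * v)) * v"
  by (simp add: quat_eq_iff u_def v_def slice_embed_def slice_proj_def inner_quat_def of_real_def)

subsection \<open>Power series on the ball\<close>

definition has_qps :: "(quat \<Rightarrow> quat) \<Rightarrow> quat fps \<Rightarrow> bool" where
  "has_qps f a \<longleftrightarrow> (\<forall>q\<in>ball 0 1. (\<lambda>k. q ^ k * fps_nth a k) sums f q)"

definition qconv :: "quat fps \<Rightarrow> bool" where
  "qconv a \<longleftrightarrow> (\<forall>r. 0 \<le> r \<longrightarrow> r < 1 \<longrightarrow> summable (\<lambda>k. r ^ k * norm (fps_nth a k)))"

definition qeval :: "quat fps \<Rightarrow> quat \<Rightarrow> quat" where
  "qeval a q = (\<Sum>k. q ^ k * fps_nth a k)"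

lemma qconvD: "qconv a \<Longrightarrow> norm (q::quat) < 1 \<Longrightarrow> summable (\<lambda>k. norm (q ^ k * fps_nth a k))"
  by (simp add: qconv_def norm_mult norm_power)

text \<open>Convergence at a real t strictly between r and 1 makes the terms at radius r decay
  geometrically, and their norms are the same in every direction. So a series has to be examined on
  the real segment only.\<close>

lemma qconv_realI:
  assumes "\<And>t. 0 \<le> t \<Longrightarrow> t < 1 \<Longrightarrow> summable (\<lambda>k. of_real t ^ k * fps_nth a k)"
  shows "qconv a"
  unfolding qconv_def
proof (intro allI impI)
  fix r :: real assume r: "0 \<le> r" "r < 1"
  define t where "t = (1 + r) / 2"
  have t: "r < t" "0 \<le> t" "t < 1"
    using r by (auto simp: t_def)
  have "summable (\<lambda>k. fps_nth a k * of_real t ^ k)"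
    using assms[OF t(2,3)] by (simp add: of_real_quat_commute flip: of_real_power)
  then have "summable (\<lambda>k. norm (fps_nth a k * of_real r ^ k))"
    by (rule powser_insidea) (use r t in auto)
  then show "summable (\<lambda>k. r ^ k * norm (fps_nth a k))"
    using r by (simp add: norm_mult norm_power mult.commute)
qed

lemma has_qps_imp_qconv: "has_qps f a \<Longrightarrow> qconv a"
  by (rule qconv_realI) (auto simp: has_qps_def intro!: sums_summable)

lemma has_qps_qeval: "qconv a \<Longrightarrow> has_qps (qeval a) a"
  unfolding has_qps_def qeval_def
  by (auto intro!: summable_sums summable_norm_cancel[OF qconvD])

lemma has_qps_eq_qeval: "has_qps f a \<Longrightarrow> q \<in> ball 0 1 \<Longrightarrow> f q = qeval a q"
  by (auto simp: has_qps_def qeval_def sums_iff)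

lemma has_qps_cong: "has_qps f a \<Longrightarrow> (\<And>q. q \<in> ball 0 1 \<Longrightarrow> f q = g q) \<Longrightarrow> has_qps g a"
  by (auto simp: has_qps_def)

lemma ps_coeff_eq: "has_qps f a \<Longrightarrow> ps_coeff f = fps_nth a"
  by (rule ps_coeff_eqI) (auto simp: has_qps_def)

lemma qconv_bounded:
  assumes "\<And>n. norm (fps_nth a n) \<le> K"
  shows "qconv a"
  unfolding qconv_def
proof (intro allI impI)
  fix r :: real assume r: "0 \<le> r" "r < 1"
  have "summable (\<lambda>k. r ^ k * K)"
    using r by (intro summable_mult2 summable_geometric) auto
  then show "summable (\<lambda>k. r ^ k * norm (fps_nth a k))"
    by (rule summable_comparison_test') (use r assms in \<open>auto intro!: mult_left_mono\<close>)
qed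

lemma has_qps_add: "has_qps f a \<Longrightarrow> has_qps g b \<Longrightarrow> has_qps (\<lambda>q. f q + g q) (a + b)"
  by (auto simp: has_qps_def distrib_left intro!: sums_add)

lemma has_qps_diff: "has_qps f a \<Longrightarrow> has_qps g b \<Longrightarrow> has_qps (\<lambda>q. f q - g q) (a - b)"
  by (auto simp: has_qps_def right_diff_distrib intro!: sums_diff)

lemma has_qps_1: "has_qps (\<lambda>q. 1) 1"
proof -
  have "(\<lambda>k. q ^ k * fps_nth 1 k) sums 1" for q :: quat
    using sums_finite[of "{0}" "\<lambda>k. q ^ k * fps_nth 1 k"] by auto
  then show ?thesis
    by (simp add: has_qps_def)
qed

lemma has_qps_0: "has_qps (\<lambda>q. 0) 0"
  by (simp add: has_qps_def)

lemma has_qps_X_mult: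
  assumes "has_qps f a"
  shows "has_qps (\<lambda>q. q * f q) (fps_X * a)"
  unfolding has_qps_def
proof
  fix q :: quat assume "q \<in> ball 0 1"
  then have "(\<lambda>k. q * (q ^ k * fps_nth a k)) sums (q * f q)"
    using assms by (auto simp: has_qps_def intro: sums_mult)
  then have "(\<lambda>k. q ^ Suc k * fps_nth (fps_X * a) (Suc k)) sums (q * f q)"
    by (simp add: mult.assoc)
  then show "(\<lambda>k. q ^ k * fps_nth (fps_X * a) k) sums (q * f q)"
    by (subst (asm) sums_Suc_iff) simp
qed

lemma quat_eq_sum_Basis: "(\<Sum>b\<in>Basis. of_real (inner x b) * b) = (x::quat)"
  using euclidean_representation[of x] by (simp add: scaleR_conv_of_real)

text \<open>Splitting $f(q)$ into real coordinates reduces the noncommutative Cauchy product to products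
  with real factors.\<close>

lemma qps_mult_sums:
  assumes f: "has_qps f a" and b: "qconv b" and q: "q \<in> ball 0 1"
  shows "(\<lambda>n. q ^ n * fps_nth (a * b) n) sums (\<Sum>k. q ^ k * f q * fps_nth b k)"
    and "summable (\<lambda>k. q ^ k * f q * fps_nth b k)"
proof -
  have q1: "norm q < 1" using q by simp
  define A where "A e r = (of_real (inner (q ^ r * fps_nth a r) e) :: quat)" for e r
  define B where "B e k = q ^ k * e * fps_nth b k" for e k
  have A: "summable (\<lambda>r. norm (A e r))" if "e \<in> Basis" for e
    using qconvD[OF has_qps_imp_qconv[OF f] q1]
    by (rule summable_comparison_test') (auto simp: A_def intro!: Basis_le_norm that)
  have B: "summable (\<lambda>k. norm (B e k))" if "e \<in> Basis" for e
    using qconvD[OF b q1] that by (simp add: B_def norm_mult)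
  have "(\<Sum>r. A e r) = of_real (inner (f q) e)" for e
  proof -
    have "(\<lambda>r. of_real (inner (q ^ r * fps_nth a r) e) :: quat) sums of_real (inner (f q) e)"
      using f q unfolding has_qps_def
      by (intro bounded_linear.sums[OF bounded_linear_of_real]
          bounded_linear.sums[OF bounded_linear_inner_left]) auto
    then show ?thesis
      by (simp add: A_def sums_iff)
  qed
  then have "(\<lambda>n. \<Sum>r\<le>n. A e r * B e (n - r)) sums (of_real (inner (f q) e) * (\<Sum>k. B e k))"
    if "e \<in> Basis" for e
    using Cauchy_product_sums[OF A[OF that] B[OF that]] by simp
  then have 1: "(\<lambda>n. \<Sum>e\<in>Basis. \<Sum>r\<le>n. A e r * B e (n - r)) sums
      (\<Sum>e\<in>Basis. of_real (inner (f q) e) * (\<Sum>k. B e k))"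
    by (rule sums_sum)
  \<comment> \<open>Summing over the basis reinserts the quaternion x between q^k and the
    coefficient. With x = f q this gives the evaluation formula, with x = q^r a_r the Cauchy
    product.\<close>
  have 2: "(\<Sum>e\<in>Basis. of_real (inner x e) * B e k) = q ^ k * x * fps_nth b k" for x k
  proof -
    have "(\<Sum>e\<in>Basis. of_real (inner x e) * B e k) =
        (\<Sum>e\<in>Basis. q ^ k * (of_real (inner x e) * e) * fps_nth b k)"
      by (simp add: B_def mult.assoc) (simp add: of_real_def)
    also have "\<dots> = q ^ k * (\<Sum>e\<in>Basis. of_real (inner x e) * e) * fps_nth b k"
      by (simp only: sum_distrib_left sum_distrib_right)
    finally show ?thesis by (simp add: quat_eq_sum_Basis)
  qed
  have 3: "(\<Sum>e\<in>Basis. \<Sum>r\<le>n. A e r * B e (n - r)) = q ^ n * fps_nth (a * b) n" for n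
  proof -
    have "(\<Sum>e\<in>Basis. \<Sum>r\<le>n. A e r * B e (n - r)) =
        (\<Sum>r\<le>n. \<Sum>e\<in>Basis. of_real (inner (q ^ r * fps_nth a r) e) * B e (n - r))"
      unfolding A_def by (rule sum.swap)
    also have "\<dots> = (\<Sum>r\<le>n. q ^ n * (fps_nth a r * fps_nth b (n - r)))"
      unfolding 2
    proof (intro sum.cong refl)
      fix r assume "r \<in> {..n}"
      then have "q ^ n = q ^ (n - r) * q ^ r"
        by (simp flip: power_add)
      then show "q ^ (n - r) * (q ^ r * fps_nth a r) * fps_nth b (n - r) =
          q ^ n * (fps_nth a r * fps_nth b (n - r))"
        by (simp add: mult.assoc)
    qed
    finally show ?thesis
      by (simp add: fps_mult_nth sum_distrib_left atLeast0AtMost)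
  qed
  have 4: "(\<lambda>k. \<Sum>e\<in>Basis. of_real (inner (f q) e) * B e k) sums
      (\<Sum>e\<in>Basis. of_real (inner (f q) e) * (\<Sum>k. B e k))"
    by (intro sums_sum sums_mult summable_sums summable_norm_cancel[OF B])
  show "summable (\<lambda>k. q ^ k * f q * fps_nth b k)"
    using 4 unfolding 2 by (simp add: sums_iff)
  show "(\<lambda>n. q ^ n * fps_nth (a * b) n) sums (\<Sum>k. q ^ k * f q * fps_nth b k)"
    using 1 4 unfolding 2 3 by (simp add: sums_iff)
qed

lemma qconv_mult: "qconv a \<Longrightarrow> qconv b \<Longrightarrow> qconv (a * b)"
  by (rule has_qps_imp_qconv[of "\<lambda>q. \<Sum>k. q ^ k * qeval a q * fps_nth b k"])
    (auto simp: has_qps_def intro!: qps_mult_sums(1) has_qps_qeval)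

lemma has_qps_star_prod:
  assumes "has_qps f a" "has_qps g b"
  shows "has_qps (f \<star> g) (a * b)"
proof -
  have "(f \<star> g) q = qeval (a * b) q" for q
    unfolding star_prod_def qeval_def ps_coeff_eq[OF assms(1)] ps_coeff_eq[OF assms(2)]
    by (simp add: fps_mult_nth atLeast0AtMost)
  then show ?thesis
    using has_qps_qeval[OF qconv_mult] assms[THEN has_qps_imp_qconv] by (simp add: has_qps_def)
qed

definition fps_qcnj :: "quat fps \<Rightarrow> quat fps" where
  "fps_qcnj a = Abs_fps (\<lambda>n. qcnj (fps_nth a n))"

lemma fps_qcnj_nth [simp]: "fps_nth (fps_qcnj a) n = qcnj (fps_nth a n)"
  by (simp add: fps_qcnj_def)

lemma fps_qcnj_mult: "fps_qcnj (a * b) = fps_qcnj b * fps_qcnj a"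
proof (rule fps_ext)
  fix n
  have "fps_nth (fps_qcnj (a * b)) n = (\<Sum>i=0..n. qcnj (fps_nth b (n - i)) * qcnj (fps_nth a i))"
    by (simp add: fps_mult_nth qcnj_sum)
  also have "\<dots> = fps_nth (fps_qcnj b * fps_qcnj a) n"
    by (subst sum.atLeastAtMost_rev) (auto simp: fps_mult_nth intro!: sum.cong)
  finally show "fps_nth (fps_qcnj (a * b)) n = fps_nth (fps_qcnj b * fps_qcnj a) n" .
qed

lemma fps_qcnj_fps_qcnj [simp]: "fps_qcnj (fps_qcnj a) = a"
  by (rule fps_ext) simp

lemma fps_qcnj_1 [simp]: "fps_qcnj 1 = 1"
  by (rule fps_ext) simp

lemma qconv_qcnj: "qconv a \<Longrightarrow> qconv (fps_qcnj a)"
  by (simp add: qconv_def)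

lemma has_qps_star_conj:
  assumes "has_qps f a"
  shows "has_qps (star_conj f) (fps_qcnj a)"
  using has_qps_qeval[OF qconv_qcnj[OF has_qps_imp_qconv[OF assms]]]
  by (rule has_qps_cong) (simp add: qeval_def star_conj_def ps_coeff_eq[OF assms])

text \<open>The symmetrization s of d has real coefficients, hence is central, and the
  symmetrization of e inverts it. A zero of s at q would annihilate the value of that product, which
  is 1. Since s(q) moreover commutes with q, evaluation is multiplicative on s * e, and s * e =
  \<open>fps_qcnj d\<close> identifies e(q) with the pointwise formula for the star inverse.\<close>

lemma star_inv_props:
  assumes f: "has_qps f d" and e: "qconv e" and de: "d * e = 1"
  shows "q \<in> ball 0 1 \<Longrightarrow> star_inv_defined_at f q"
    and "has_qps (star_inv f) e"
proof -
  define s where "s = fps_qcnj d * d"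
  have hs: "has_qps (star_conj f \<star> f) s"
    unfolding s_def by (intro has_qps_star_prod has_qps_star_conj f)
  have dce: "fps_qcnj e * fps_qcnj d = 1"
    using fps_qcnj_mult[of d e] de by simp
  have se: "s * e = fps_qcnj d"
    by (simp add: s_def mult.assoc de)
  have es: "fps_qcnj e * (s * e) = 1"
    by (simp add: se dce)
  have s_real: "fps_nth s n = of_real (q_re (fps_nth s n))" for n
  proof -
    have "fps_qcnj s = s"
      by (simp add: s_def fps_qcnj_mult)
    then have "qcnj (fps_nth s n) = fps_nth s n"
      by (metis fps_qcnj_nth)
    then show ?thesis
      by (auto simp: quat_eq_iff of_real_def)
  qed
  have s_comm: "s * x = x * s" for x
  proof (rule fps_ext)
    fix n
    have "fps_nth (s * x) n = (\<Sum>i=0..n. fps_nth x (n - i) * fps_nth s i)"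
      unfolding fps_mult_nth by (intro sum.cong refl) (metis s_real of_real_quat_commute)
    also have "\<dots> = fps_nth (x * s) n"
      by (subst sum.atLeastAtMost_rev) (auto simp: fps_mult_nth intro!: sum.cong)
    finally show "fps_nth (s * x) n = fps_nth (x * s) n" .
  qed
  have es1: "s * (fps_qcnj e * e) = 1"
    using es s_comm by (metis mult.assoc)
  show nz: "star_inv_defined_at f q" if q: "q \<in> ball 0 1" for q
  proof (unfold star_inv_defined_at_def, rule notI)
    assume "(star_conj f \<star> f) q = 0"
    then have "(\<lambda>n. q ^ n * fps_nth (s * (fps_qcnj e * e)) n) sums 0"
      using qps_mult_sums(1)[OF hs qconv_mult[OF qconv_qcnj[OF e] e] q] by simp
    moreover have "(\<lambda>n. q ^ n * fps_nth 1 n) sums 1"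
      using has_qps_1 q by (auto simp: has_qps_def)
    ultimately show False
      unfolding es1 using sums_unique2 by fastforce
  qed
  show "has_qps (star_inv f) e"
  proof (rule has_qps_cong[OF has_qps_qeval[OF e]])
    fix q :: quat assume q: "q \<in> ball 0 1"
    define t where "t = (star_conj f \<star> f) q"
    have t: "t \<noteq> 0"
      using nz[OF q] by (simp add: t_def star_inv_defined_at_def)
    have ts: "(\<lambda>k. q ^ k * fps_nth s k) sums t"
      using hs q by (auto simp: has_qps_def t_def)
    have "(\<lambda>k. q * (q ^ k * fps_nth s k)) sums (q * t)"
      "(\<lambda>k. q ^ k * fps_nth s k * q) sums (t * q)"
      by (intro sums_mult sums_mult2 ts)+
    moreover have "q ^ k * fps_nth s k * q = q * (q ^ k * fps_nth s k)" for k
      by (subst (1 2) s_real) (metis mult.assoc of_real_quat_commute power_commutes)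
    ultimately have "q * t = t * q"
      by (simp add: sums_iff)
    then have comm: "q ^ k * t = t * q ^ k" for k
      by (metis power_commuting_commutes)
    have "(\<lambda>n. q ^ n * fps_nth (s * e) n) sums (\<Sum>k. q ^ k * t * fps_nth e k)"
      unfolding t_def by (rule qps_mult_sums(1)[OF hs e q])
    also have "(\<Sum>k. q ^ k * t * fps_nth e k) = (\<Sum>k. t * (q ^ k * fps_nth e k))"
      by (simp add: comm mult.assoc)
    also have "\<dots> = t * qeval e q"
      unfolding qeval_def
      by (rule suminf_mult) (rule summable_norm_cancel[OF qconvD[OF e]], use q in simp)
    finally have "star_conj f q = t * qeval e q"
      using has_qps_star_conj[OF f] q unfolding se has_qps_def
      by (metis sums_unique2)
    then show "qeval e q = star_inv f q"
      using t by (simp add: star_inv_def flip: t_def) (simp flip: mult.assoc)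
  qed
qed

subsection \<open>Slice regular functions and power series\<close>

text \<open>The sum of q^i h q^(k-1-i) over i < k; it differs from k q^(k-1) h when h does not
  commute with q.\<close>

primrec qpow_deriv :: "nat \<Rightarrow> quat \<Rightarrow> quat \<Rightarrow> quat" where
  "qpow_deriv 0 q h = 0"
| "qpow_deriv (Suc k) q h = h * q ^ k + q * qpow_deriv k q h"

lemma has_derivative_qpow:
  "((\<lambda>q. q ^ k) has_derivative qpow_deriv k q) (at q within S)"
proof (induction k)
  case (Suc k)
  have "((\<lambda>q. q * q ^ k) has_derivative (\<lambda>h. q * qpow_deriv k q h + h * q ^ k)) (at q within S)"
    by (intro has_derivative_mult has_derivative_ident Suc.IH)
  moreover have "(\<lambda>h. q * qpow_deriv k q h + h * q ^ k) = qpow_deriv (Suc k) q"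
    by (auto simp: add.commute)
  ultimately show ?case
    by (simp only: power_Suc)
qed (simp add: fun_eq_iff)

lemma norm_qpow_deriv_le:
  assumes "norm q \<le> r"
  shows "norm (qpow_deriv k q h) \<le> real k * r ^ (k - 1) * norm h"
proof (induction k)
  case (Suc k)
  have r: "0 \<le> r"
    using assms norm_ge_zero order_trans by blast
  have "norm (qpow_deriv (Suc k) q h) \<le> norm h * norm q ^ k + norm q * norm (qpow_deriv k q h)"
    using norm_triangle_ineq[of "h * q ^ k" "q * qpow_deriv k q h"] by (simp add: norm_mult norm_power)
  also have "\<dots> \<le> norm h * r ^ k + r * (real k * r ^ (k - 1) * norm h)"
    using assms r Suc.IH by (intro add_mono mult_mono power_mono) auto
  also have "\<dots> = real (Suc k) * r ^ (Suc k - 1) * norm h"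
    by (cases k) (auto simp: algebra_simps)
  finally show ?case .
qed simp

text \<open>The Cauchy-Riemann equation for monomials: at a point of C_u the direction u commutes
  with q and can be pulled out to the left.\<close>

lemma qpow_deriv_commute:
  assumes "q * u = u * q"
  shows "qpow_deriv k q u = u * qpow_deriv k q 1"
proof (induction k)
  case (Suc k)
  have "q * qpow_deriv k q u = u * (q * qpow_deriv k q 1)"
    unfolding Suc.IH by (simp add: assms flip: mult.assoc)
  then show ?case
    by (simp add: distrib_left)
qed simp

lemma summable_qpow_deriv_bound:
  assumes "qconv a" "0 \<le> r" "r < 1"
  shows "summable (\<lambda>k. real k * r ^ (k - 1) * norm (fps_nth a k))"
proof -
  have "summable (\<lambda>n. norm (fps_nth a n) * x ^ n)" if "norm x < 1" for x :: real
  proof (rule summable_norm_cancel)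
    show "summable (\<lambda>n. norm (norm (fps_nth a n) * x ^ n))"
      using assms(1)[unfolded qconv_def, rule_format, of "\<bar>x\<bar>"] that
      by (simp add: norm_mult norm_power abs_mult power_abs mult.commute)
  qed
  then have "summable (\<lambda>n. diffs (\<lambda>n. norm (fps_nth a n)) n * r ^ n)"
    using assms by (intro termdiff_converges[of r 1]) auto
  then have "summable (\<lambda>n. real (Suc n) * r ^ (Suc n - 1) * norm (fps_nth a (Suc n)))"
    by (simp add: diffs_def algebra_simps)
  then show ?thesis
    using summable_Suc_iff[of "\<lambda>k. real k * r ^ (k - 1) * norm (fps_nth a k)"] by blast
qed

lemma has_qps_has_derivative:
  assumes f: "has_qps f a" and x: "x \<in> ball 0 1"
  shows "(f has_derivative (\<lambda>h. \<Sum>k. qpow_deriv k x h * fps_nth a k)) (at x)"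
proof -
  \<comment> \<open>Any radius strictly between |x| and 1: x is interior to the ball of radius r,
    and the majorants \<open>M k\<close> are uniform on it.\<close>
  define r where "r = (1 + norm x) / 2"
  have r: "norm x < r" "0 \<le> r" "r < 1"
    using x by (auto simp: r_def)
  define M where "M k = real k * r ^ (k - 1) * norm (fps_nth a k)" for k
  have M: "summable M"
    unfolding M_def by (rule summable_qpow_deriv_bound[OF has_qps_imp_qconv[OF f] r(2,3)])
  have le: "norm (qpow_deriv k y h * fps_nth a k) \<le> M k * norm h" if "y \<in> ball 0 r" for k and y h :: quat
    using mult_right_mono[OF norm_qpow_deriv_le[of y r k h], of "norm (fps_nth a k)"] that
    by (simp add: M_def norm_mult mult_ac)
  have "\<exists>g. \<forall>y\<in>ball (0::quat) r. (\<lambda>n. y ^ n * fps_nth a n) sums g y \<and>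
      (g has_derivative (\<lambda>h. \<Sum>k. qpow_deriv k y h * fps_nth a k)) (at y within ball 0 r)"
  proof (rule has_derivative_series[where x = x and l = "f x"])
    show "((\<lambda>q. q ^ n * fps_nth a n) has_derivative (\<lambda>h. qpow_deriv n y h * fps_nth a n))
        (at y within ball 0 r)" for n and y :: quat
      by (intro has_derivative_mult_left has_derivative_qpow)
    show "(\<lambda>n. x ^ n * fps_nth a n) sums f x"
      using f x by (auto simp: has_qps_def)
    fix e :: real assume "e > 0"
    then obtain N where N: "\<And>n. n \<ge> N \<Longrightarrow> norm (\<Sum>i. M (i + n)) < e"
      using suminf_exist_split[OF _ M] by blast
    show "\<forall>\<^sub>F n in sequentially. \<forall>y\<in>ball 0 r. \<forall>h.
        norm ((\<Sum>i<n. qpow_deriv i y h * fps_nth a i) - (\<Sum>k. qpow_deriv k y h * fps_nth a k)) \<le> e * norm h"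
      unfolding eventually_sequentially
    proof (intro exI[of _ N] allI impI ballI)
      fix n and y h :: quat assume n: "N \<le> n" and y: "y \<in> ball 0 r"
      have s: "summable (\<lambda>k. norm (qpow_deriv k y h * fps_nth a k))"
        by (rule summable_comparison_test'[OF summable_mult2[OF M, of "norm h"]])
          (use le[OF y] in auto)
      have "norm ((\<Sum>i<n. qpow_deriv i y h * fps_nth a i) - (\<Sum>k. qpow_deriv k y h * fps_nth a k))
          = norm (\<Sum>k. qpow_deriv (k + n) y h * fps_nth a (k + n))"
        by (subst suminf_split_initial_segment[OF summable_norm_cancel[OF s], of n])
          (simp add: norm_minus_commute)
      also have "\<dots> \<le> (\<Sum>k. norm (qpow_deriv (k + n) y h * fps_nth a (k + n)))"
        by (rule summable_norm) (use summable_ignore_initial_segment[OF s, of n] in simp)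
      also have "\<dots> \<le> (\<Sum>k. M (k + n) * norm h)"
        by (intro suminf_le le[OF y] summable_mult2 summable_ignore_initial_segment[OF M])
          (use summable_ignore_initial_segment[OF s, of n] in simp)
      also have "\<dots> = (\<Sum>k. M (k + n)) * norm h"
        by (intro suminf_mult2[symmetric] summable_ignore_initial_segment[OF M])
      also have "\<dots> \<le> e * norm h"
        using N[OF n] by (intro mult_right_mono) auto
      finally show "norm ((\<Sum>i<n. qpow_deriv i y h * fps_nth a i)
          - (\<Sum>k. qpow_deriv k y h * fps_nth a k)) \<le> e * norm h" .
    qed
  qed (use r in auto)
  then obtain g :: "quat \<Rightarrow> quat" where G: "\<forall>y\<in>ball 0 r. (\<lambda>n. y ^ n * fps_nth a n) sums g y \<and>
      (g has_derivative (\<lambda>h. \<Sum>k. qpow_deriv k y h * fps_nth a k)) (at y within ball 0 r)"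
    by blast
  then have g: "(\<lambda>n. y ^ n * fps_nth a n) sums g y" if "y \<in> ball 0 r" for y
    using that by blast
  have dg: "(g has_derivative (\<lambda>h. \<Sum>k. qpow_deriv k x h * fps_nth a k)) (at x within ball 0 r)"
    using G r(1) by simp
  have "g y = f y" if "y \<in> ball 0 r" for y :: quat
    using g[OF that] f r that unfolding has_qps_def by (auto intro: sums_unique2)
  then have "(f has_derivative (\<lambda>h. \<Sum>k. qpow_deriv k x h * fps_nth a k)) (at x within ball 0 r)"
    by (intro has_derivative_transform[OF _ _ dg]) (use r(1) in auto)
  then show ?thesis
    using r(1) by (simp add: at_within_open[of x "ball 0 r"])
qed

lemma slice_embed_derivatives:
  assumes "(f has_derivative L) (at (slice_embed u (Complex x y)))"
  shows "((\<lambda>t. f (of_real t + u * of_real y)) has_vector_derivative L 1) (at x)"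
    and "((\<lambda>t. f (of_real x + u * of_real t)) has_vector_derivative L u) (at y)"
proof -
  have L: "L (r *\<^sub>R h) = r *\<^sub>R L h" for r h
    using has_derivative_linear[OF assms] by (simp add: linear_cmul)
  have 1: "((\<lambda>t. of_real t + u * of_real y) has_derivative (\<lambda>t. t *\<^sub>R 1)) (at x)"
    unfolding of_real_def by (auto intro!: derivative_eq_intros)
  have 2: "((\<lambda>t. of_real x + u * of_real t) has_derivative (\<lambda>t. t *\<^sub>R u)) (at y)"
    unfolding of_real_def by (auto intro!: derivative_eq_intros)
  show "((\<lambda>t. f (of_real t + u * of_real y)) has_vector_derivative L 1) (at x)"
    using has_derivative_compose[OF 1, of f L] assms
    by (simp add: has_vector_derivative_def slice_embed_def L)
  show "((\<lambda>t. f (of_real x + u * of_real t)) has_vector_derivative L u) (at y)"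
    using has_derivative_compose[OF 2, of f L] assms
    by (simp add: has_vector_derivative_def slice_embed_def L)
qed

text \<open>Both partial derivatives along a slice are values of the one real derivative L.
  Multiplying L 1 + u L u = 0 by u turns the Cauchy-Riemann equation into left C_u-linearity of L on
  the slice.\<close>

lemma slice_regular_ball_iff:
  "f \<in> slice_regular_ball \<longleftrightarrow>
    (\<forall>u\<in>imag_sphere. \<forall>z\<in>ball 0 1. \<exists>L. (f has_derivative L) (at (slice_embed u z)) \<and> L u = u * L 1)"
    (is "_ \<longleftrightarrow> ?R")
proof
  assume f: "f \<in> slice_regular_ball"
  show ?R
  proof (intro ballI)
    fix u :: quat and z :: complex assume u: "u \<in> imag_sphere" and z: "z \<in> ball 0 1"
    then have q: "slice_embed u z \<in> ball 0 1"
      by simp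
    have reg: "slice_regular_on (ball 0 1) f"
      using f by (simp add: slice_regular_ball_def)
    then have "f differentiable_on ball 0 1"
      by (simp add: slice_regular_on_def)
    then have "f differentiable at (slice_embed u z) within ball 0 1"
      using q by (simp only: differentiable_on_def)
    then obtain L where L: "(f has_derivative L) (at (slice_embed u z))"
      using at_within_open[OF q open_ball] by (auto simp: differentiable_def)
    have "vector_derivative (\<lambda>t. f (of_real t + u * of_real (Im z))) (at (Re z))
        + u * vector_derivative (\<lambda>t. f (of_real (Re z) + u * of_real t)) (at (Im z)) = 0"
      using reg u q[unfolded slice_embed_def] unfolding slice_regular_on_def by blast
    moreover have "(f has_derivative L) (at (slice_embed u (Complex (Re z) (Im z))))"
      using L by simp
    note slice_embed_derivatives[OF this, THEN vector_derivative_at]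
    ultimately have "L 1 + u * L u = 0"
      by simp
    then have "u * (L 1 + u * L u) = 0"
      by simp
    then have "u * L 1 + u * u * L u = 0"
      by (simp only: distrib_left mult.assoc)
    then have "L u = u * L 1"
      using imag_sphere_square[OF u] by simp
    with L show "\<exists>L. (f has_derivative L) (at (slice_embed u z)) \<and> L u = u * L 1"
      by blast
  qed
next
  assume R: ?R
  have "f differentiable_on ball 0 1"
    unfolding differentiable_on_def
  proof
    fix q :: quat assume q: "q \<in> ball 0 1"
    obtain u z where u: "u \<in> imag_sphere" and z: "q = slice_embed u z"
      by (rule slice_embed_surj)
    then have "z \<in> ball 0 1"
      using q by simp
    then obtain L where "(f has_derivative L) (at q)"
      using R u z by blast
    then show "f differentiable at q within ball 0 1"
      using at_within_open[OF q open_ball] by (auto simp: differentiable_def)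
  qed
  moreover have "vector_derivative (\<lambda>t. f (of_real t + u * of_real y)) (at x)
      + u * vector_derivative (\<lambda>t. f (of_real x + u * of_real t)) (at y) = 0"
    if u: "u \<in> imag_sphere" and q: "of_real x + u * of_real y \<in> ball 0 1" for u x y
  proof -
    have "slice_embed u (Complex x y) \<in> ball 0 1"
      using q by (simp add: slice_embed_def)
    then have "Complex x y \<in> ball 0 1"
      using u by simp
    then obtain L where L: "(f has_derivative L) (at (slice_embed u (Complex x y)))" "L u = u * L 1"
      using R u by blast
    have "u * (u * L 1) = - L 1"
      using imag_sphere_square[OF u] by (simp flip: mult.assoc)
    then show ?thesis
      using slice_embed_derivatives[OF L(1), THEN vector_derivative_at] L(2) by simp
  qed
  ultimately show "f \<in> slice_regular_ball"
    by (simp add: slice_regular_ball_def slice_regular_on_def)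
qed

lemma has_qps_imp_slice_regular:
  assumes f: "has_qps f a"
  shows "f \<in> slice_regular_ball"
  unfolding slice_regular_ball_iff
proof (intro ballI exI conjI)
  fix u :: quat and z :: complex assume u: "u \<in> imag_sphere" and "z \<in> ball 0 1"
  then have q: "slice_embed u z \<in> ball 0 1"
    by simp
  show "(f has_derivative (\<lambda>h. \<Sum>k. qpow_deriv k (slice_embed u z) h * fps_nth a k)) (at (slice_embed u z))"
    by (rule has_qps_has_derivative[OF f q])
  have "slice_embed u z * u = u * slice_embed u z"
    by (simp add: slice_embed_def of_real_def algebra_simps)
  then have "qpow_deriv k (slice_embed u z) u = u * qpow_deriv k (slice_embed u z) 1" for k
    by (rule qpow_deriv_commute)
  moreover have "summable (\<lambda>k. qpow_deriv k (slice_embed u z) 1 * fps_nth a k)"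
  proof (rule summable_comparison_test')
    show "summable (\<lambda>k. real k * norm z ^ (k - 1) * norm (fps_nth a k))"
      using q u by (intro summable_qpow_deriv_bound has_qps_imp_qconv[OF f]) auto
    show "norm (qpow_deriv k (slice_embed u z) 1 * fps_nth a k) \<le> real k * norm z ^ (k - 1) * norm (fps_nth a k)"
      for k
      using mult_right_mono[OF norm_qpow_deriv_le[of "slice_embed u z" "norm z" k 1] norm_ge_zero] u
      by (simp add: norm_mult)
  qed
  ultimately show "(\<Sum>k. qpow_deriv k (slice_embed u z) u * fps_nth a k) =
      u * (\<Sum>k. qpow_deriv k (slice_embed u z) 1 * fps_nth a k)"
    by (simp only: mult.assoc suminf_mult)
qed

text \<open>Left C_u-linearity of the derivative survives right multiplication, so w is free;
  \<open>slice_proj_zero_imp\<close> and \<open>slice_decomp\<close> rely on that freedom.\<close>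

lemma slice_proj_holomorphic:
  assumes f: "f \<in> slice_regular_ball" and u: "u \<in> imag_sphere"
  shows "(\<lambda>z. slice_proj u (f (slice_embed u z) * w)) holomorphic_on ball 0 1"
proof (rule holomorphic_onI)
  fix z :: complex assume z: "z \<in> ball 0 1"
  then obtain L where L: "(f has_derivative L) (at (slice_embed u z))" "L u = u * L 1"
    using f u unfolding slice_regular_ball_iff by blast
  interpret L: bounded_linear L
    using L(1) by (rule has_derivative_bounded_linear)
  have LL: "L (slice_embed u h) = slice_embed u h * L 1" for h
  proof -
    have "slice_embed u h = Re h *\<^sub>R 1 + Im h *\<^sub>R u"
      by (simp add: slice_embed_def of_real_def)
    then show ?thesis
      by (simp add: L.add L.scaleR L(2) distrib_right)
  qed
  have "((\<lambda>z. slice_embed u z) has_derivative slice_embed u) (at z)"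
    unfolding slice_embed_def of_real_def by (auto intro!: derivative_eq_intros)
  from has_derivative_compose[OF this, of f L] L(1)
  have "((\<lambda>z. f (slice_embed u z)) has_derivative (\<lambda>h. slice_embed u h * L 1)) (at z)"
    by (simp add: LL)
  then have "((\<lambda>z. slice_proj u (f (slice_embed u z) * w)) has_derivative
      (\<lambda>h. slice_proj u (slice_embed u h * L 1 * w))) (at z)"
    by (intro bounded_linear.has_derivative[OF bounded_linear_slice_proj] has_derivative_mult_left)
  then have "((\<lambda>z. slice_proj u (f (slice_embed u z) * w)) has_field_derivative slice_proj u (L 1 * w)) (at z)"
    by (simp add: has_field_derivative_def mult.assoc slice_proj_slice_embed_mult[OF u] mult_commute_abs)
  then show "(\<lambda>z. slice_proj u (f (slice_embed u z) * w)) field_differentiable at z within ball 0 1"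
    using field_differentiable_at_within field_differentiable_def by blast
qed

text \<open>By this identity principle it suffices to expand a slice regular function on a single slice.\<close>

lemma slice_regular_eq_on_reals:
  assumes f: "f \<in> slice_regular_ball" and g: "g \<in> slice_regular_ball"
    and eq: "\<And>t. \<bar>t\<bar> < 1 \<Longrightarrow> f (of_real t) = g (of_real t)" and q: "q \<in> ball 0 1"
  shows "f q = g q"
proof -
  obtain u z where u: "u \<in> imag_sphere" and z: "q = slice_embed u z"
    by (rule slice_embed_surj)
  have "slice_proj u ((f q - g q) * w) = 0" for w
  proof -
    define F where "F z = slice_proj u (f (slice_embed u z) * w) - slice_proj u (g (slice_embed u z) * w)" for z
    have "F z = 0"
    proof (rule analytic_continuation[of F "ball 0 1" "of_real ` {-1<..<1}" 0])
      show "F holomorphic_on ball 0 1"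
        unfolding F_def by (intro holomorphic_intros slice_proj_holomorphic f g u)
      show "(0::complex) islimpt complex_of_real ` {-1<..<1}"
        unfolding islimpt_approachable
      proof (intro allI impI)
        fix e :: real assume "e > 0"
        define d where "d = min e 1 / 2"
        with \<open>e > 0\<close> have "0 < d" "d < e" "d < 1"
          by auto
        then show "\<exists>x'\<in>complex_of_real ` {-1<..<1}. x' \<noteq> 0 \<and> dist x' 0 < e"
          by (intro bexI[of _ "of_real d"] imageI) auto
      qed
      show "F t = 0" if "t \<in> complex_of_real ` {-1<..<1}" for t
        using that by (auto simp: F_def eq abs_less_iff)
      show "z \<in> ball 0 1"
        using q u z by simp
    qed auto
    then show ?thesis
      by (simp add: F_def z left_diff_distrib linear_diff[OF bounded_linear.linear[OF bounded_linear_slice_proj]])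
  qed
  then have "f q - g q = 0"
    by (rule slice_proj_zero_imp)
  then show ?thesis
    by simp
qed

lemma slice_regular_imp_has_qps:
  assumes f: "f \<in> slice_regular_ball"
  obtains a where "has_qps f a"
proof -
  define u v where "u = Quat 0 1 0 0" and "v = Quat 0 0 1 0"
  have u: "u \<in> imag_sphere"
    by (simp add: u_def imag_sphere_def norm_quat_def)
  \<comment> \<open>By \<open>slice_decomp\<close> the holomorphic functions \<open>F 1\<close> and
    \<open>F v\<close> together determine f on C_u; their Taylor coefficients are combined into
    those of f in the same way.\<close>
  define F where "F w z = slice_proj u (f (slice_embed u z) * w)" for w z
  define c where "c w k = (deriv ^^ k) (F w) 0 / fact k" for w k
  have F: "(\<lambda>k. z ^ k * c w k) sums F w z" if "norm z < 1" for w z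
    using holomorphic_power_series[OF slice_proj_holomorphic[OF f u], of z w] that
    unfolding c_def F_def by (simp add: mult.commute)
  have "linear (slice_embed u)"
    by (rule linearI) (simp_all add: slice_embed_def of_real_def distrib_left scaleR_add_left scaleR_add_right)
  then have "bounded_linear (slice_embed u)"
    by (simp add: linear_conv_bounded_linear)
  from bounded_linear.sums[OF this F]
  have c: "(\<lambda>k. slice_embed u z ^ k * slice_embed u (c w k)) sums slice_embed u (F w z)"
    if "norm z < 1" for w z
    using that by (simp add: slice_embed_mult[OF u] slice_embed_power[OF u])
  define a where "a = Abs_fps (\<lambda>k. slice_embed u (c 1 k) - slice_embed u (c v k) * v)"
  have a: "(\<lambda>k. slice_embed u z ^ k * fps_nth a k) sums f (slice_embed u z)" if "norm z < 1" for z
  proof -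
    have "(\<lambda>k. slice_embed u z ^ k * slice_embed u (c 1 k) - slice_embed u z ^ k * slice_embed u (c v k) * v) sums
      (slice_embed u (F 1 z) - slice_embed u (F v z) * v)"
      by (intro sums_diff sums_mult2 c that)
    then show ?thesis
      using slice_decomp[of "f (slice_embed u z)"]
      by (simp add: a_def F_def right_diff_distrib mult.assoc flip: u_def v_def)
  qed
  have "qconv a"
  proof (rule qconv_realI)
    fix t :: real assume "0 \<le> t" "t < 1"
    then show "summable (\<lambda>k. of_real t ^ k * fps_nth a k)"
      using a[of "of_real t"] by (simp add: sums_iff)
  qed
  then have h: "has_qps (qeval a) a"
    by (rule has_qps_qeval)
  have eq: "qeval a (of_real t) = f (of_real t)" if "\<bar>t\<bar> < 1" for t
    using a[of "of_real t"] that by (simp add: qeval_def sums_iff)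
  have "qeval a q = f q" if q: "q \<in> ball 0 1" for q
  proof -
    note reg = slice_regular_eq_on_reals[OF has_qps_imp_slice_regular[OF h]]
    note reg = reg[OF f]
    note reg = reg[OF eq]
    show ?thesis
      by (rule reg[OF _ q])
  qed
  then have "has_qps f a"
    using has_qps_cong[OF h, of f] by simp
  then show ?thesis
    by (rule that)
qed

subsection \<open>Schur functions as contractive multipliers\<close>

text \<open>The first N coefficients of a * h depend only on those of h, so contractivity can be
  demanded of every formal h, without a Hardy space and without convergence.\<close>

definition schur_fps :: "quat fps \<Rightarrow> bool" where
  "schur_fps a \<longleftrightarrow> (\<forall>h N. (\<Sum>n<N. (norm (fps_nth (a * h) n))\<^sup>2) \<le> (\<Sum>n<N. (norm (fps_nth h n))\<^sup>2))"

lemma schur_fpsD: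
  "schur_fps a \<Longrightarrow> (\<Sum>n<N. (norm (fps_nth (a * h) n))\<^sup>2) \<le> (\<Sum>n<N. (norm (fps_nth h n))\<^sup>2)"
  by (simp add: schur_fps_def)

lemma schur_fps_coeff_le:
  assumes "schur_fps a"
  shows "norm (fps_nth a n) \<le> 1"
proof -
  have "(\<Sum>i<Suc n. (norm (fps_nth 1 i :: quat))\<^sup>2) = (\<Sum>i<Suc n. if i = 0 then 1 else 0)"
    by (intro sum.cong) auto
  also have "\<dots> = 1"
    by (subst sum.delta) auto
  finally have "(\<Sum>i<Suc n. (norm (fps_nth a i))\<^sup>2) \<le> 1"
    using schur_fpsD[OF assms, of 1 "Suc n"] by (simp del: sum.lessThan_Suc)
  moreover have "(norm (fps_nth a n))\<^sup>2 \<le> (\<Sum>i<Suc n. (norm (fps_nth a i))\<^sup>2)"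
    by (intro member_le_sum) auto
  ultimately have "(norm (fps_nth a n))\<^sup>2 \<le> 1\<^sup>2"
    by simp
  then show ?thesis
    by (rule power2_le_imp_le) simp
qed

lemma schur_fps_imp_qconv: "schur_fps a \<Longrightarrow> qconv a"
  by (rule qconv_bounded[of _ 1]) (rule schur_fps_coeff_le)

text \<open>Test the contraction on $h_k = \overline{q^k f(q)}$, the image of the reproducing kernel at
  $q$ under the adjoint multiplier.\<close>

lemma schur_fps_norm_le:
  assumes a: "schur_fps a" and f: "has_qps f a" and q: "q \<in> ball 0 1"
  shows "norm (f q) \<le> 1"
proof -
  define F where "F = (norm (f q))\<^sup>2"
  define x where "x = (norm q)\<^sup>2"
  define h where "h = Abs_fps (\<lambda>k. qcnj (q ^ k * f q))"
  define T where "T = 1 / (1 - x)"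
  have x: "0 \<le> x" "x < 1"
    using q by (auto simp: x_def power_less_one_iff abs_square_less_1)
  have T: "(\<lambda>k. x ^ k) sums T"
    using geometric_sums[of x] x by (simp add: T_def)
  have T_le: "(\<Sum>k<N. x ^ k) \<le> T" for N
    using sum_le_suminf[of "\<lambda>k. x ^ k" "{..<N}"] T x by (auto simp: sums_iff)
  have h: "(norm (fps_nth h k))\<^sup>2 = F * x ^ k" for k
    by (simp add: h_def F_def x_def norm_mult norm_power power_mult_distrib power_mult[symmetric] mult.commute)
  have "q ^ k * f q * fps_nth h k = of_real (F * x ^ k)" for k
  proof -
    have "(norm (q ^ k * f q))\<^sup>2 = F * x ^ k"
      using h[of k] by (simp add: h_def del: qcnj_mult)
    then show ?thesis
      using qcnj_mult_self(2)[of "q ^ k * f q"] by (simp add: h_def del: qcnj_mult)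
  qed
  moreover have "(\<lambda>k. of_real (F * x ^ k) :: quat) sums of_real (F * T)"
    by (intro bounded_linear.sums[OF bounded_linear_of_real] sums_mult T)
  moreover have "qconv h"
  proof (rule qconv_bounded)
    fix k
    have "(norm (fps_nth h k))\<^sup>2 \<le> (norm (f q))\<^sup>2"
      unfolding h F_def using x by (simp add: power_le_one mult_left_le)
    then show "norm (fps_nth h k) \<le> norm (f q)"
      by (rule power2_le_imp_le) simp
  qed
  ultimately have "(\<lambda>n. q ^ n * fps_nth (a * h) n) sums of_real (F * T)"
    using qps_mult_sums(1)[OF f _ q, of h] by (simp add: sums_iff)
  then have "(\<lambda>N. norm (\<Sum>n<N. q ^ n * fps_nth (a * h) n)) \<longlonglongrightarrow> norm (of_real (F * T) :: quat)"
    unfolding sums_def by (rule tendsto_norm)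
  \<comment> \<open>Termwise 2xy \<le> x^2 + y^2 replaces Cauchy-Schwarz: the limit F * T of the
    left side reappears on the right with weight one half, which leaves F * T \<le> T.\<close>
  moreover have "norm (\<Sum>n<N. q ^ n * fps_nth (a * h) n) \<le> (T + F * T) / 2" for N
  proof -
    have "norm (\<Sum>n<N. q ^ n * fps_nth (a * h) n) \<le> (\<Sum>n<N. norm q ^ n * norm (fps_nth (a * h) n))"
      by (rule order_trans[OF norm_sum]) (simp add: norm_mult norm_power)
    also have "\<dots> \<le> (\<Sum>n<N. (x ^ n + (norm (fps_nth (a * h) n))\<^sup>2) / 2)"
    proof (rule sum_mono)
      fix n
      have "0 \<le> (norm q ^ n - norm (fps_nth (a * h) n))\<^sup>2"
        by simp
      moreover have "(norm q ^ n)\<^sup>2 = x ^ n"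
        by (simp add: x_def power_mult[symmetric] mult.commute)
      ultimately show "norm q ^ n * norm (fps_nth (a * h) n) \<le> (x ^ n + (norm (fps_nth (a * h) n))\<^sup>2) / 2"
        by (simp add: power2_diff)
    qed
    also have "\<dots> = ((\<Sum>n<N. x ^ n) + (\<Sum>n<N. (norm (fps_nth (a * h) n))\<^sup>2)) / 2"
      by (simp add: sum.distrib flip: sum_divide_distrib)
    also have "\<dots> \<le> ((\<Sum>n<N. x ^ n) + F * (\<Sum>n<N. x ^ n)) / 2"
      using schur_fpsD[OF a, where h = h and N = N] by (simp add: h sum_distrib_left)
    also have "\<dots> \<le> (T + F * T) / 2"
      using T_le[of N] by (intro divide_right_mono add_mono mult_left_mono) (auto simp: F_def)
    finally show ?thesis .
  qed
  ultimately have "norm (of_real (F * T) :: quat) \<le> (T + F * T) / 2"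
    by (intro LIMSEQ_le_const2) auto
  then have "F * T \<le> (T + F * T) / 2"
    unfolding norm_of_real by (rule order_trans[OF abs_ge_self])
  then have "F * T \<le> 1 * T"
    by simp
  moreover have "0 < T"
    using x by (simp add: T_def)
  ultimately have "F \<le> 1"
    by (rule mult_right_le_imp_le)
  then show ?thesis
    by (simp add: F_def power_le_one_iff abs_square_le_1)
qed

text \<open>On the sphere of $z$ one has $f = A + vB$ with $A$, $B$ independent of $v$, and the right
  evaluation at a point of that sphere has the same norm as some $A + vB$.\<close>

lemma sphere_norm_le:
  assumes le: "\<And>v. v \<in> imag_sphere \<Longrightarrow> norm (A + v * B) \<le> 1" and u: "u \<in> imag_sphere"
  shows "norm (A * c + B * c * u) \<le> norm c"
proof (cases "A = 0 \<or> c = 0")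
  case True
  then show ?thesis
    using le[OF u] u by (auto simp: norm_mult imag_sphere_def mult_left_le_one_le)
next
  case False
  define I where "I = c * u * inverse c"
  \<comment> \<open>Chosen so that v is the conjugate of I satisfying
    \<open>qcnj A * v = I * qcnj A\<close>; this makes the cross terms of |A + B I|^2 and |A + v
    B|^2 equal.\<close>
  define d where "d = inverse (qcnj A) * c"
  define v where "v = d * u * inverse d"
  have I: "I \<in> imag_sphere" and v: "v \<in> imag_sphere"
    using False u by (auto simp: I_def v_def d_def intro!: imag_sphere_conjugate)
  have v_eq: "qcnj A * v = I * qcnj A"
    using False by (simp add: v_def d_def I_def nonzero_inverse_mult_distrib) (simp flip: mult.assoc)
  have "inner A (B * I) = q_re (qcnj A * B * I)"
    by (simp only: inner_quat_eq mult.assoc)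
  also have "\<dots> = q_re (I * qcnj A * B)"
    by (subst q_re_mult_commute) (simp only: mult.assoc)
  also have "\<dots> = inner A (v * B)"
    by (simp only: inner_quat_eq v_eq[symmetric] mult.assoc)
  finally have "(norm (A + B * I))\<^sup>2 = (norm (A + v * B))\<^sup>2"
    using I v unfolding power2_norm_eq_inner inner_add_left inner_add_right
    by (simp add: inner_commute flip: power2_norm_eq_inner) (simp add: norm_mult imag_sphere_def)
  then have "norm (A + B * I) \<le> 1"
    using le[OF v] by simp
  moreover have "A * c + B * c * u = (A + B * I) * c"
    using False by (simp add: I_def distrib_right mult.assoc)
  ultimately show ?thesis
    by (simp add: norm_mult mult_left_le_one_le)
qed

text \<open>Splitting z^k into real and imaginary part yields the same A and B for both kinds of
  evaluation: powers on the left give A + v B, powers on the right give A c + B c u.\<close>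

lemma right_eval_bound:
  assumes f: "has_qps f a" and le: "\<forall>q\<in>ball 0 1. norm (f q) \<le> 1"
    and u: "u \<in> imag_sphere" and z: "norm z < 1"
  shows "summable (\<lambda>k. fps_nth a k * c * slice_embed u z ^ k)"
    and "norm (\<Sum>k. fps_nth a k * c * slice_embed u z ^ k) \<le> norm c"
proof -
  have s: "summable (\<lambda>k. norm z ^ k * norm (fps_nth a k))"
    using has_qps_imp_qconv[OF f] z by (simp add: qconv_def)
  define A where "A = (\<Sum>k. Re (z ^ k) *\<^sub>R fps_nth a k)"
  define B where "B = (\<Sum>k. Im (z ^ k) *\<^sub>R fps_nth a k)"
  have A: "(\<lambda>k. Re (z ^ k) *\<^sub>R fps_nth a k) sums A"
    unfolding A_def
    by (intro summable_sums summable_comparison_test'[OF s])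
      (auto intro!: mult_right_mono order_trans[OF abs_Re_le_cmod] simp: norm_power)
  have B: "(\<lambda>k. Im (z ^ k) *\<^sub>R fps_nth a k) sums B"
    unfolding B_def
    by (intro summable_sums summable_comparison_test'[OF s])
      (auto intro!: mult_right_mono order_trans[OF abs_Im_le_cmod] simp: norm_power)
  have le1: "norm (A + v * B) \<le> 1" if v: "v \<in> imag_sphere" for v
  proof -
    have q: "slice_embed v z \<in> ball 0 1"
      using v z by simp
    have "(\<lambda>k. Re (z ^ k) *\<^sub>R fps_nth a k + v * Im (z ^ k) *\<^sub>R fps_nth a k) sums (A + v * B)"
      by (intro sums_add sums_mult A B)
    moreover have "Re (z ^ k) *\<^sub>R fps_nth a k + v * Im (z ^ k) *\<^sub>R fps_nth a k = slice_embed v z ^ k * fps_nth a k" for k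
      unfolding slice_embed_power[OF v, symmetric] by (simp add: slice_embed_def of_real_def distrib_right)
    ultimately have "f (slice_embed v z) = A + v * B"
      using f q by (auto simp: has_qps_def intro: sums_unique2)
    then show ?thesis
      using bspec[OF le q] by simp
  qed
  have "(\<lambda>k. (Re (z ^ k) *\<^sub>R fps_nth a k) * c + (Im (z ^ k) *\<^sub>R fps_nth a k) * c * u) sums (A * c + B * c * u)"
    by (intro sums_add sums_mult2 A B)
  moreover have "(Re (z ^ k) *\<^sub>R fps_nth a k) * c + (Im (z ^ k) *\<^sub>R fps_nth a k) * c * u =
      fps_nth a k * c * slice_embed u z ^ k" for k
    unfolding slice_embed_power[OF u, symmetric] by (simp add: slice_embed_def of_real_def distrib_left mult.assoc)
  ultimately have "(\<lambda>k. fps_nth a k * c * slice_embed u z ^ k) sums (A * c + B * c * u)"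
    by simp
  then show "summable (\<lambda>k. fps_nth a k * c * slice_embed u z ^ k)"
    and "norm (\<Sum>k. fps_nth a k * c * slice_embed u z ^ k) \<le> norm c"
    using sphere_norm_le[OF le1 u, of c] by (auto simp: sums_iff)
qed

text \<open>Orthogonality of the L-th roots of unity in C_u, used in place of an integral over the
  circle. It tolerates quaternion coefficients because the powers stand on the right: in the inner
  product they meet and combine within the commutative field C_u.\<close>

lemma discrete_parseval:
  fixes b :: "nat \<Rightarrow> quat"
  assumes u: "u \<in> imag_sphere" and L: "L > 0"
  defines "W \<equiv> \<lambda>j::nat. slice_embed u (cis (2 * pi * real j / real L))"
  shows "(\<Sum>j<L. (norm (\<Sum>n<L. b n * W j ^ n))\<^sup>2) = real L * (\<Sum>n<L. (norm (b n))\<^sup>2)"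
proof -
  define w where "w j = cis (2 * pi * real j / real L)" for j :: nat
  have w_pow: "w j ^ n = w n ^ j" for j n
    unfolding w_def Complex.DeMoivre by (rule arg_cong[of _ _ cis]) simp
  have w_L: "w n ^ L = 1" for n
  proof -
    have "real L * (2 * pi * real n / real L) = 2 * pi * real n"
      using L by simp
    then show ?thesis
      unfolding w_def Complex.DeMoivre by (simp only: cis_multiple_2pi Ints_of_nat)
  qed
  have W: "W j = slice_embed u (w j)" for j
    by (simp add: W_def w_def)
  have orth: "(\<Sum>j<L. w j ^ n * cnj (w j ^ m)) = (if n = m then of_nat L else 0)"
    if "n < L" "m < L" for m n
  proof -
    define t where "t = w n * cnj (w m)"
    have sum_t: "(\<Sum>j<L. w j ^ n * cnj (w j ^ m)) = (\<Sum>j<L. t ^ j)"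
      by (intro sum.cong) (simp_all add: t_def power_mult_distrib w_pow[of _ n] w_pow[of _ m])
    show ?thesis
    proof (cases "n = m")
      case True
      then have "t = 1"
        by (simp add: t_def w_def cis_cnj cis_mult)
      with True sum_t show ?thesis
        by simp
    next
      case False
      have "t \<noteq> 1"
      proof
        assume "t = 1"
        then have "w n * (cnj (w m) * w m) = w m"
          by (simp add: t_def mult.assoc[symmetric])
        then have "w n = w m"
          by (simp add: w_def cis_cnj cis_mult)
        then have "n = m"
          using bij_betw_imp_inj_on[OF Complex.bij_betw_roots_unity[OF L]] that
          by (auto simp: inj_on_def w_def)
        with False show False by simp
      qed
      moreover have "t ^ L = 1"
        by (simp add: t_def power_mult_distrib w_L flip: complex_cnj_power)
      ultimately show ?thesis
        using False sum_t by (simp add: geometric_sum)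
    qed
  qed
  have inner_eq: "inner (b m * W j ^ m) (b n * W j ^ n) =
      inner (b m) (b n * slice_embed u (w j ^ n * cnj (w j ^ m)))" for j m n
  proof -
    have "qcnj (slice_embed u z) = slice_embed u (cnj z)" for z
      by (simp add: slice_embed_def imag_sphere_qcnj[OF u] of_real_quat_commute)
    then have "qcnj (W j ^ m) = slice_embed u (cnj (w j ^ m))"
      unfolding W slice_embed_power[OF u, symmetric] .
    then show ?thesis
      by (simp only: inner_quat_mult_right slice_embed_mult[OF u] slice_embed_power[OF u] W mult.assoc)
  qed
  have slice_sum: "slice_embed u (sum g A) = (\<Sum>x\<in>A. slice_embed u (g x))" for g :: "nat \<Rightarrow> complex" and A
    by (induction A rule: infinite_finite_induct) (simp_all add: slice_embed_add)
  have orth': "(\<Sum>j<L. slice_embed u (w j ^ n * cnj (w j ^ m))) = of_real (if n = m then real L else 0)"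
    if "n < L" "m < L" for m n
  proof -
    have "(\<Sum>j<L. slice_embed u (w j ^ n * cnj (w j ^ m))) = slice_embed u (of_real (if n = m then real L else 0))"
      unfolding slice_sum[symmetric] orth[OF that] by (intro arg_cong[of _ _ "slice_embed u"]) simp
    then show ?thesis
      by (simp only: slice_embed_of_real)
  qed
  have "(\<Sum>j<L. (norm (\<Sum>n<L. b n * W j ^ n))\<^sup>2) =
      (\<Sum>j<L. \<Sum>m<L. \<Sum>n<L. inner (b m) (b n * slice_embed u (w j ^ n * cnj (w j ^ m))))"
    unfolding power2_norm_eq_inner inner_sum_left inner_sum_right inner_eq
    by (intro sum.cong refl sum.swap)
  also have "\<dots> = (\<Sum>m<L. \<Sum>n<L. \<Sum>j<L. inner (b m) (b n * slice_embed u (w j ^ n * cnj (w j ^ m))))"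
    by (subst sum.swap) (intro sum.cong refl sum.swap)
  also have "\<dots> = (\<Sum>m<L. \<Sum>n<L. inner (b m) (b n * (\<Sum>j<L. slice_embed u (w j ^ n * cnj (w j ^ m)))))"
    by (simp only: inner_sum_right sum_distrib_left)
  also have "\<dots> = (\<Sum>m<L. \<Sum>n<L. if n = m then real L * (norm (b m))\<^sup>2 else 0)"
    by (intro sum.cong refl) (auto simp: orth' power2_norm_eq_inner of_real_def simp del: complex_cnj_power)
  also have "\<dots> = real L * (\<Sum>n<L. (norm (b n))\<^sup>2)"
    by (simp add: sum_distrib_left)
  finally show ?thesis .
qed

text \<open>Right evaluation suits left multiplication by a: if c is the right value of h at q, then
  that of a * h is \<Sum> a_r c q^r, so it depends on h only through c. As h is a polynomial, the
  sums are interchanged over finitely many k.\<close>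

lemma right_eval_mult:
  assumes f: "has_qps f a" and le: "\<forall>q\<in>ball 0 1. norm (f q) \<le> 1"
    and u: "u \<in> imag_sphere" and z: "norm z < 1" and h: "\<And>n. n \<ge> N \<Longrightarrow> fps_nth h n = 0"
  defines "q \<equiv> slice_embed u z"
  obtains s where "(\<lambda>n. fps_nth (a * h) n * q ^ n) sums s"
    "norm s \<le> norm (\<Sum>k<N. fps_nth h k * q ^ k)"
proof -
  define R where "R c = (\<Sum>r. fps_nth a r * c * q ^ r)" for c
  have R: "(\<lambda>r. fps_nth a r * c * q ^ r) sums R c" for c
    unfolding R_def q_def by (intro summable_sums right_eval_bound(1)[OF f le u z])
  define F where "F k n = (if k \<le> n then fps_nth a (n - k) * fps_nth h k * q ^ n else 0)" for k n
  have "F k sums R (fps_nth h k * q ^ k)" for k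
  proof -
    have "F k (i + k) = fps_nth a i * (fps_nth h k * q ^ k) * q ^ i" for i
      by (simp add: F_def mult.assoc add.commute flip: power_add)
    then have "(\<lambda>i. F k (i + k)) sums R (fps_nth h k * q ^ k)"
      using R[of "fps_nth h k * q ^ k"] by simp
    moreover have "(\<Sum>i<k. F k i) = 0"
      by (intro sum.neutral) (auto simp: F_def)
    ultimately show ?thesis
      using sums_iff_shift[of "F k" k "R (fps_nth h k * q ^ k)"] by simp
  qed
  then have "(\<lambda>n. \<Sum>k<N. F k n) sums (\<Sum>k<N. R (fps_nth h k * q ^ k))"
    by (intro sums_sum)
  moreover have "(\<Sum>k<N. F k n) = fps_nth (a * h) n * q ^ n" for n
  proof -
    have "fps_nth (a * h) n * q ^ n = (\<Sum>i=0..n. fps_nth a (n - i) * fps_nth h i * q ^ n)"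
      unfolding fps_mult_nth sum_distrib_right by (subst sum.atLeastAtMost_rev) simp
    also have "\<dots> = (\<Sum>i\<in>{0..n} \<inter> {..<N}. fps_nth a (n - i) * fps_nth h i * q ^ n)"
      using h by (intro sum.mono_neutral_right) auto
    also have "\<dots> = (\<Sum>k<N. F k n)"
      by (rule sum.mono_neutral_cong_left) (auto simp: F_def)
    finally show ?thesis ..
  qed
  moreover have "(\<Sum>k<N. R (fps_nth h k * q ^ k)) = R (\<Sum>k<N. fps_nth h k * q ^ k)"
  proof -
    have "(\<lambda>r. \<Sum>k<N. fps_nth a r * (fps_nth h k * q ^ k) * q ^ r) sums (\<Sum>k<N. R (fps_nth h k * q ^ k))"
      by (intro sums_sum R)
    then have "(\<lambda>r. fps_nth a r * (\<Sum>k<N. fps_nth h k * q ^ k) * q ^ r) sums (\<Sum>k<N. R (fps_nth h k * q ^ k))"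
      by (simp only: sum_distrib_left sum_distrib_right)
    then show ?thesis
      using R[of "\<Sum>k<N. fps_nth h k * q ^ k"] by (simp only: sums_iff)
  qed
  moreover have "norm (R c) \<le> norm c" for c
    unfolding R_def q_def by (rule right_eval_bound(2)[OF f le u z])
  ultimately show ?thesis
    by (intro that[of "R (\<Sum>k<N. fps_nth h k * q ^ k)"]) simp_all
qed

text \<open>The weight r^n moves the sampling to a circle inside the ball, where a * h converges
  absolutely. There the right values of a * h are dominated by those of h, and the discrete Parseval
  identity converts this to coefficients.\<close>

lemma norm_le_one_imp_weighted_contraction:
  assumes f: "has_qps f a" and le: "\<forall>q\<in>ball 0 1. norm (f q) \<le> 1"
    and h: "\<And>n. n \<ge> N \<Longrightarrow> fps_nth h n = 0" and r: "0 < r" "r < 1"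
  shows "(\<Sum>n<N. (norm (fps_nth (a * h) n) * r ^ n)\<^sup>2) \<le> (\<Sum>n<N. (norm (fps_nth h n))\<^sup>2)"
proof -
  define u where "u = Quat 0 1 0 0"
  have u: "u \<in> imag_sphere"
    by (simp add: u_def imag_sphere_def norm_quat_def)
  have "qconv h"
    unfolding qconv_def by (intro allI impI summable_finite[of "{..<N}"]) (auto simp: h)
  then have "qconv (a * h)"
    by (intro qconv_mult has_qps_imp_qconv[OF f])
  define b where "b n = of_real (r ^ n) * fps_nth (a * h) n" for n
  define M where "M = (\<Sum>k<N. norm (fps_nth h k))"
  have b: "summable (\<lambda>n. norm (b n))"
    using \<open>qconv (a * h)\<close> r by (simp add: qconv_def b_def norm_mult norm_power)
  define e where "e L = (\<Sum>n. norm (b (n + L)))" for L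
  have e: "e \<longlonglongrightarrow> 0"
    unfolding e_def by (rule suminf_exist_split2[OF b])
  have e_nonneg: "0 \<le> e L" for L
    unfolding e_def by (intro suminf_nonneg summable_ignore_initial_segment[OF b]) auto
  \<comment> \<open>With L sample points the only error comes from the coefficients b_n with n \<ge>
    L, bounded by \<open>e L\<close>. The correction term stems from (c + e)^2 = c^2 + (2 c + e) e
    and c \<le> M.\<close>
  have main: "(\<Sum>n<N. (norm (b n))\<^sup>2) \<le> (\<Sum>n<N. (norm (fps_nth h n))\<^sup>2) + (2 * M + e L) * e L"
    if L: "L \<ge> N" "L > 0" for L
  proof -
    define w where "w j = cis (2 * pi * real j / real L)" for j :: nat
    define W where "W j = slice_embed u (w j)" for j
    have W_le: "norm (W j) = 1" for j
      using u by (simp add: W_def w_def)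
    have q_pow: "slice_embed u (of_real r * w j) ^ n = of_real (r ^ n) * W j ^ n" for j n
    proof -
      have "slice_embed u (of_real r * w j) ^ n = slice_embed u (of_real (r ^ n)) * slice_embed u (w j ^ n)"
        by (simp add: power_mult_distrib flip: slice_embed_mult[OF u] slice_embed_power[OF u])
      then show ?thesis
        unfolding W_def slice_embed_power[OF u] slice_embed_of_real .
    qed
    define c where "c j = (\<Sum>k<L. (of_real (r ^ k) * fps_nth h k) * W j ^ k)" for j
    have c_eq: "(\<Sum>k<N. fps_nth h k * slice_embed u (of_real r * w j) ^ k) = c j" for j
      unfolding c_def q_pow
      by (rule sum.mono_neutral_cong_left) (use L in \<open>auto simp: h mult.assoc of_real_def\<close>)
    have c_le: "norm (c j) \<le> M" for j
      unfolding c_eq[symmetric] M_def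
    proof (rule order_trans[OF norm_sum], rule sum_mono)
      fix k
      have "r ^ k \<le> 1"
        using r by (intro power_le_one) auto
      then show "norm (fps_nth h k * slice_embed u (of_real r * w j) ^ k) \<le> norm (fps_nth h k)"
        using r by (simp add: q_pow norm_mult norm_power W_le mult_left_le)
    qed
    have bc: "norm (\<Sum>n<L. b n * W j ^ n) \<le> norm (c j) + e L" for j
    proof -
      have "norm (of_real r * w j) < 1"
        using r by (simp add: norm_mult w_def)
      then obtain s where s: "(\<lambda>n. fps_nth (a * h) n * slice_embed u (of_real r * w j) ^ n) sums s"
        and sc: "norm s \<le> norm (c j)"
        unfolding c_eq[symmetric] by (rule right_eval_mult[OF f le u _ h])
      have s: "(\<lambda>n. b n * W j ^ n) sums s"
        using s unfolding q_pow b_def by (simp add: mult.assoc of_real_def)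
      have sn: "summable (\<lambda>n. norm (b (n + L) * W j ^ (n + L)))"
        using summable_ignore_initial_segment[OF b, of L] by (simp add: norm_mult norm_power W_le)
      have "(\<Sum>n<L. b n * W j ^ n) = s - (\<Sum>n. b (n + L) * W j ^ (n + L))"
        using suminf_split_initial_segment[of "\<lambda>n. b n * W j ^ n" L] s by (simp add: sums_iff)
      also have "norm \<dots> \<le> norm s + norm (\<Sum>n. b (n + L) * W j ^ (n + L))"
        by (rule norm_triangle_ineq4)
      also have "norm (\<Sum>n. b (n + L) * W j ^ (n + L)) \<le> e L"
        using summable_norm[OF sn] by (simp add: e_def norm_mult norm_power W_le)
      finally show ?thesis
        using sc by simp
    qed
    have "real L * (\<Sum>n<N. (norm (b n))\<^sup>2) \<le> real L * (\<Sum>n<L. (norm (b n))\<^sup>2)"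
      using L by (intro mult_left_mono sum_mono2) auto
    also have "\<dots> = (\<Sum>j<L. (norm (\<Sum>n<L. b n * W j ^ n))\<^sup>2)"
      unfolding W_def w_def by (rule discrete_parseval[OF u L(2), symmetric])
    also have "\<dots> \<le> (\<Sum>j<L. (norm (c j))\<^sup>2 + (2 * M + e L) * e L)"
    proof (rule sum_mono)
      fix j
      have "(norm (\<Sum>n<L. b n * W j ^ n))\<^sup>2 \<le> (norm (c j) + e L)\<^sup>2"
        by (intro power_mono bc) auto
      also have "\<dots> = (norm (c j))\<^sup>2 + (2 * norm (c j) + e L) * e L"
        by (simp add: power2_eq_square algebra_simps)
      also have "\<dots> \<le> (norm (c j))\<^sup>2 + (2 * M + e L) * e L"
        using c_le e_nonneg by (intro add_left_mono mult_right_mono) auto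
      finally show "(norm (\<Sum>n<L. b n * W j ^ n))\<^sup>2 \<le> (norm (c j))\<^sup>2 + (2 * M + e L) * e L" .
    qed
    also have "\<dots> = (\<Sum>j<L. (norm (c j))\<^sup>2) + real L * ((2 * M + e L) * e L)"
      by (simp add: sum.distrib)
    also have "(\<Sum>j<L. (norm (c j))\<^sup>2) = real L * (\<Sum>k<L. (norm (of_real (r ^ k) * fps_nth h k))\<^sup>2)"
      unfolding c_def W_def w_def by (rule discrete_parseval[OF u L(2)])
    also have "(\<Sum>k<L. (norm (of_real (r ^ k) * fps_nth h k))\<^sup>2) = (\<Sum>k<N. (norm (of_real (r ^ k) * fps_nth h k))\<^sup>2)"
      by (rule sum.mono_neutral_right) (use L in \<open>auto simp: h\<close>)
    also have "\<dots> \<le> (\<Sum>k<N. (norm (fps_nth h k))\<^sup>2)"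
    proof (intro sum_mono power_mono norm_ge_zero)
      fix k
      have "r ^ k \<le> 1"
        using r by (intro power_le_one) auto
      then show "norm (of_real (r ^ k) * fps_nth h k) \<le> norm (fps_nth h k)"
        using r by (simp add: norm_mult norm_power mult_left_le_one_le)
    qed
    finally have "real L * (\<Sum>n<N. (norm (b n))\<^sup>2) \<le>
        real L * ((\<Sum>k<N. (norm (fps_nth h k))\<^sup>2) + (2 * M + e L) * e L)"
      by (simp add: distrib_left mult_left_mono)
    then show ?thesis
      using L by (simp add: mult_le_cancel_left)
  qed
  have "(\<lambda>L. (\<Sum>n<N. (norm (fps_nth h n))\<^sup>2) + (2 * M + e L) * e L) \<longlonglongrightarrow>
      (\<Sum>n<N. (norm (fps_nth h n))\<^sup>2) + (2 * M + 0) * 0"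
    by (intro tendsto_intros e)
  then have "(\<Sum>n<N. (norm (b n))\<^sup>2) \<le> (\<Sum>n<N. (norm (fps_nth h n))\<^sup>2) + (2 * M + 0) * 0"
    by (rule LIMSEQ_le_const) (use main in \<open>auto intro!: exI[of _ "Suc N"]\<close>)
  moreover have "norm (b n) = norm (fps_nth (a * h) n) * r ^ n" for n
    using r by (simp add: b_def norm_mult norm_power mult.commute)
  ultimately show ?thesis
    by simp
qed

lemma norm_le_one_imp_schur:
  assumes f: "has_qps f a" and le: "\<forall>q\<in>ball 0 1. norm (f q) \<le> 1"
  shows "schur_fps a"
  unfolding schur_fps_def
proof (intro allI)
  fix h :: "quat fps" and N
  \<comment> \<open>By causality h may be cut off to a polynomial; then both sides are finite sums
    and r can tend to 1.\<close>
  define h' where "h' = fps_cutoff N h"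
  have 1: "fps_nth (a * h') n = fps_nth (a * h) n" if "n < N" for n
    unfolding fps_mult_nth using that by (intro sum.cong) (auto simp: h'_def)
  have "((\<lambda>r. \<Sum>n<N. (norm (fps_nth (a * h') n) * r ^ n)\<^sup>2) \<longlongrightarrow>
      (\<Sum>n<N. (norm (fps_nth (a * h') n) * 1 ^ n)\<^sup>2)) (at_left 1)"
    by (intro tendsto_intros)
  moreover have "\<forall>\<^sub>F r in at_left (1::real). 0 < r \<and> r < 1"
    using eventually_at_left_real[of 0 1] by (auto elim: eventually_mono)
  then have "\<forall>\<^sub>F r in at_left 1. (\<Sum>n<N. (norm (fps_nth (a * h') n) * r ^ n)\<^sup>2) \<le> (\<Sum>n<N. (norm (fps_nth h' n))\<^sup>2)"
    by (rule eventually_mono) (intro norm_le_one_imp_weighted_contraction[OF f le], auto simp: h'_def)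
  ultimately have "(\<Sum>n<N. (norm (fps_nth (a * h') n) * 1 ^ n)\<^sup>2) \<le> (\<Sum>n<N. (norm (fps_nth h' n))\<^sup>2)"
    by (rule tendsto_upperbound) simp
  then show "(\<Sum>n<N. (norm (fps_nth (a * h) n))\<^sup>2) \<le> (\<Sum>n<N. (norm (fps_nth h n))\<^sup>2)"
    by (simp add: 1) (simp add: h'_def)
qed

lemma slice_schur_iff: "f \<in> slice_schur \<longleftrightarrow> (\<exists>a. has_qps f a \<and> schur_fps a)"
proof
  assume "f \<in> slice_schur"
  then have f: "f \<in> slice_regular_ball" and le: "\<forall>q\<in>ball 0 1. norm (f q) \<le> 1"
    by (auto simp: slice_schur_def)
  obtain a where "has_qps f a"
    using slice_regular_imp_has_qps[OF f] .
  with norm_le_one_imp_schur[OF this le] show "\<exists>a. has_qps f a \<and> schur_fps a"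
    by blast
next
  assume "\<exists>a. has_qps f a \<and> schur_fps a"
  then show "f \<in> slice_schur"
    using has_qps_imp_slice_regular schur_fps_norm_le by (auto simp: slice_schur_def)
qed

subsection \<open>Positive definite quaternionic matrices\<close>

lemma matrix_vector_mult_nth: "(A *v x) $ i = (\<Sum>j\<in>UNIV. A $ i $ j * x $ j)"
  by (simp add: matrix_vector_mult_def)

lemma linear_quat_matrix_vector: "linear ((*v) (A :: quat ^ 'n ^ 'm))"
  by (rule linearI)
    (simp_all add: vec_eq_iff matrix_vector_mult_nth distrib_left sum.distrib scaleR_sum_right)

lemma pos_definite_inner_pos:
  assumes "pos_definite A" "x \<noteq> 0"
  shows "inner x (A *v x) > 0"
proof -
  obtain r where "r > 0" and r: "(\<Sum>i\<in>UNIV. qcnj (x $ i) * (A *v x) $ i) = of_real r"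
    using assms unfolding pos_definite_def by blast
  have q_re_sum: "q_re (sum f B) = (\<Sum>x\<in>B. q_re (f x))" for f :: "'b \<Rightarrow> quat" and B
    by (induction B rule: infinite_finite_induct) simp_all
  have "inner x (A *v x) = (\<Sum>i\<in>UNIV. q_re (qcnj (x $ i) * (A *v x) $ i))"
    unfolding inner_vec_def inner_quat_eq ..
  also have "\<dots> = r"
    unfolding q_re_sum[symmetric] r by simp
  finally show ?thesis
    using \<open>r > 0\<close> by simp
qed

lemma hermitian_inner_commute:
  assumes "ctranspose A = A"
  shows "inner (A *v x) y = inner x (A *v y)"
proof -
  have A: "qcnj (A $ i $ j) = A $ j $ i" for i j
    using assms by (auto simp: ctranspose_def vec_eq_iff)
  have "inner (A *v x) y = (\<Sum>i\<in>UNIV. \<Sum>j\<in>UNIV. inner (x $ j) (A $ j $ i * y $ i))"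
    by (simp add: inner_vec_def matrix_vector_mult_nth inner_sum_left inner_quat_mult_left A)
  also have "\<dots> = inner x (A *v y)"
    by (subst sum.swap) (simp add: inner_vec_def matrix_vector_mult_nth inner_sum_right)
  finally show ?thesis .
qed

text \<open>A is injective and real linear on a finite-dimensional real space, hence surjective, and
  the solutions of A c_j = e_j are the columns of a right inverse B. From A (B A - 1) = 0 and
  injectivity B is also a left inverse.\<close>

lemma pos_definite_inverse:
  fixes A :: "quat ^ 'n ^ 'n"
  assumes "pos_definite A"
  shows "A ** matrix_inv A = mat 1" "matrix_inv A ** A = mat 1"
proof -
  have inj: "x = 0" if "A *v x = 0" for x
    using pos_definite_inner_pos[OF assms, of x] that by force
  then have "inj ((*v) A)"
    using linear_injective_0[OF linear_quat_matrix_vector] by blast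
  then have surj: "surj ((*v) A)"
    by (intro linear_injective_imp_surjective[OF linear_quat_matrix_vector] refl)
  define e :: "'n \<Rightarrow> quat ^ 'n" where "e j = (\<chi> i. if i = j then 1 else 0)" for j
  have "\<exists>x. A *v x = e j" for j
    using surj by (metis surjD)
  then obtain c where c: "\<And>j. A *v c j = e j"
    by metis
  define B where "B = (\<chi> i j. c j $ i)"
  have AB: "A ** B = mat 1"
    using c by (simp add: vec_eq_iff matrix_vector_mult_nth matrix_matrix_mult_def B_def e_def mat_def)
  have "(B ** A - mat 1) *v x = 0" for x
  proof (rule inj)
    have "A *v ((B ** A - mat 1) *v x) = (A ** B) *v (A *v x) - A *v x"
      by (simp add: matrix_vector_mult_diff_rdistrib matrix_vector_mult_diff_distrib matrix_vector_mul_assoc matrix_mul_assoc)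
    then show "A *v ((B ** A - mat 1) *v x) = 0"
      by (simp add: AB)
  qed
  then have "((B ** A - mat 1) *v e j) $ i = 0" for i j
    by simp
  moreover have "(M *v e j) $ i = M $ i $ j" for M :: "quat ^ 'n ^ 'n" and i j
  proof -
    have "(M *v e j) $ i = (\<Sum>k\<in>UNIV. if k = j then M $ i $ k else 0)"
      unfolding matrix_vector_mult_nth e_def by (intro sum.cong) auto
    then show ?thesis by simp
  qed
  ultimately have "B ** A = mat 1"
    by (simp add: vec_eq_iff)
  with AB have "\<exists>B. A ** B = mat 1 \<and> B ** A = mat 1"
    by blast
  from someI_ex[OF this] show "A ** matrix_inv A = mat 1" "matrix_inv A ** A = mat 1"
    by (auto simp: matrix_inv_def)
qed

text \<open>K is the reciprocal of the minimum of the form on the compact unit sphere. This converts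
  energy bounds on states into norm bounds.\<close>

lemma pos_definite_coercive:
  fixes A :: "quat ^ 'n ^ 'n"
  assumes "pos_definite A"
  shows "\<exists>K\<ge>0. \<forall>x. (norm x)\<^sup>2 \<le> K * inner x (A *v x)"
proof -
  have lin: "linear ((*v) A)"
    by (rule linear_quat_matrix_vector)
  have ne: "sphere (0 :: quat ^ 'n) 1 \<noteq> {}"
    by simp
  have "continuous_on (sphere 0 1) (\<lambda>x. inner x (A *v x))"
    by (intro continuous_intros linear_continuous_on) (simp add: linear_conv_bounded_linear[symmetric] lin)
  then obtain w where w: "w \<in> sphere 0 1" and min: "\<forall>x\<in>sphere 0 1. inner w (A *v w) \<le> inner x (A *v x)"
    using continuous_attains_inf[OF compact_sphere ne] by blast
  define m where "m = inner w (A *v w)"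
  have m: "m > 0"
    unfolding m_def using w by (intro pos_definite_inner_pos[OF assms]) auto
  show ?thesis
  proof (intro exI conjI allI)
    show "0 \<le> 1 / m"
      using m by simp
    fix x
    show "(norm x)\<^sup>2 \<le> 1 / m * inner x (A *v x)"
    proof (cases "x = 0")
      case False
      then have "m \<le> inner (x /\<^sub>R norm x) (A *v (x /\<^sub>R norm x))"
        unfolding m_def by (intro bspec[OF min]) simp
      also have "\<dots> = inner x (A *v x) / (norm x)\<^sup>2"
        by (simp add: linear_cmul[OF lin] power2_eq_square field_simps)
      finally show ?thesis
        using False m by (simp add: field_simps)
    qed simp
  qed
qed

subsection \<open>The state space realization of the resolvent matrix\<close>

locale pick_problem =
  fixes p s :: "'n::finite \<Rightarrow> quat"
  assumes p_less: "norm (p i) < 1"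
    and pos: "pos_definite (pick_matrix p s)"
begin

abbreviation P :: "quat ^ 'n ^ 'n" where "P \<equiv> pick_matrix p s"

text \<open>\<open>shift_adj\<close>, \<open>out1\<close> and \<open>out2\<close> are T^*, E^* and
  N^* acting on column vectors.\<close>

definition shift_adj :: "quat ^ 'n \<Rightarrow> quat ^ 'n" where
  "shift_adj x = (\<chi> i. qcnj (p i) * x $ i)"

definition out1 :: "quat ^ 'n \<Rightarrow> quat" where
  "out1 x = (\<Sum>i\<in>UNIV. x $ i)"

definition out2 :: "quat ^ 'n \<Rightarrow> quat" where
  "out2 x = (\<Sum>i\<in>UNIV. qcnj (s i) * x $ i)"

text \<open>Splitting off the term k = 0 of the Pick series gives the Stein equation
  entrywise.\<close>

lemma stein_entry: "P $ i $ j = p i * P $ i $ j * qcnj (p j) + (1 - s i * qcnj (s j))"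
proof -
  define f where "f k = p i ^ k * (1 - s i * qcnj (s j)) * qcnj (p j) ^ k" for k
  have "norm (f k) \<le> norm (1 - s i * qcnj (s j)) * norm (p i) ^ k" for k
  proof -
    have "norm (f k) = (norm (1 - s i * qcnj (s j)) * norm (p i) ^ k) * norm (p j) ^ k"
      by (simp add: f_def norm_mult norm_power)
    also have "\<dots> \<le> norm (1 - s i * qcnj (s j)) * norm (p i) ^ k"
      using p_less[of j] by (intro mult_left_le power_le_one) auto
    finally show ?thesis .
  qed
  then have f: "summable f"
    by (intro summable_comparison_test'[OF summable_mult[OF summable_geometric[of "norm (p i)"]]])
      (use p_less[of i] in auto)
  have "(\<Sum>k. f k) = (\<Sum>k. f (Suc k)) + f 0"
    using suminf_split_head[OF f] by simp
  also have "(\<lambda>k. f (Suc k)) = (\<lambda>k. p i * f k * qcnj (p j))"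
    unfolding f_def power_Suc2[of "qcnj (p j)"] by (simp add: mult.assoc fun_eq_iff)
  also have "(\<Sum>k. p i * f k * qcnj (p j)) = p i * (\<Sum>k. f k) * qcnj (p j)"
    by (simp only: suminf_mult2[OF summable_mult[OF f], symmetric] suminf_mult[OF f])
  finally show ?thesis
    by (simp add: pick_matrix_def f_def)
qed

lemma stein_vec:
  "(P *v d) $ i = p i * (P *v shift_adj d) $ i + out1 d - s i * out2 d"
proof -
  have "(P *v d) $ i = (\<Sum>j\<in>UNIV. p i * (P $ i $ j * (qcnj (p j) * d $ j)) + d $ j - s i * (qcnj (s j) * d $ j))"
    unfolding matrix_vector_mult_nth
    by (intro sum.cong refl, subst stein_entry) (simp add: algebra_simps)
  then show ?thesis
    by (simp add: matrix_vector_mult_nth shift_adj_def out1_def out2_def sum.distrib sum_subtractf sum_distrib_left)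
qed

lemma P_add: "P *v (x + y) = P *v x + P *v y" and P_diff: "P *v (x - y) = P *v x - P *v y"
  using linear_quat_matrix_vector[of P] by (simp_all add: linear_add linear_diff)

lemma P_sym: "inner (P *v x) y = inner x (P *v y)"
  using pos hermitian_inner_commute unfolding pos_definite_def by blast

lemma P_nonneg: "inner x (P *v x) \<ge> 0"
  using pos_definite_inner_pos[OF pos, of x] by (cases "x = 0") auto

text \<open>One time step, x' being the next state. The last clause says (I - T) P b = E u_1 - N
  u_2, so b is the input after passing through the rightmost factors of the resolvent matrix; T^*
  acts on x - b only.\<close>

definition step :: "quat ^ 'n \<Rightarrow> quat ^ 'n \<Rightarrow> quat ^ 'n \<Rightarrow> quat \<Rightarrow> quat \<Rightarrow> quat \<Rightarrow> quat \<Rightarrow> bool" where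
  "step x b x' u1 u2 y1 y2 \<longleftrightarrow>
     x' = shift_adj (x - b) + b \<and> y1 = out1 (x - b) + u1 \<and> y2 = out2 (x - b) + u2 \<and>
     (\<forall>i. (1 - p i) * (P *v b) $ i = u1 - s i * u2)"

text \<open>Apply the Stein equation to x - b and add P b = T P b + E u_1 - N u_2.\<close>

lemma step_back:
  assumes "step x b x' u1 u2 y1 y2"
  shows "(P *v x) $ i = p i * (P *v x') $ i + y1 - s i * y2"
proof -
  have "(P *v (x - b)) $ i = p i * (P *v shift_adj (x - b)) $ i + out1 (x - b) - s i * out2 (x - b)"
    by (rule stein_vec)
  moreover have "(P *v b) $ i = p i * (P *v b) $ i + (u1 - s i * u2)"
  proof -
    have "(1 - p i) * (P *v b) $ i = u1 - s i * u2"
      using assms by (simp only: step_def)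
    then show ?thesis
      by (simp add: left_diff_distrib diff_eq_eq add.commute)
  qed
  ultimately show ?thesis
    using assms unfolding step_def P_diff by (simp add: P_add algebra_simps)
qed

text \<open>Pair the backward recursion for P x and the equation for P b with d = x - b and add. The
  balance follows because <x, P x> - <b, P b> = <d, P (x + b)>, likewise for x' with T^* d in place
  of d, and |y_1|^2 - |u_1|^2 = <out1 d, y_1 + u_1>, likewise for the second channel.\<close>

lemma step_energy:
  assumes st: "step x b x' u1 u2 y1 y2"
  shows "inner x' (P *v x') + (norm y1)\<^sup>2 - (norm y2)\<^sup>2 = inner x (P *v x) + (norm u1)\<^sup>2 - (norm u2)\<^sup>2"
proof -
  define d where "d = x - b"
  have x: "x = d + b"
    by (simp add: d_def)
  have x': "x' = shift_adj d + b" and y1: "y1 = out1 d + u1" and y2: "y2 = out2 d + u2"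
    and b: "(1 - p i) * (P *v b) $ i = u1 - s i * u2" for i
    using st by (auto simp: step_def d_def)
  have pair: "(\<Sum>i\<in>UNIV. inner (d $ i) (p i * v $ i + w1 - s i * w2)) =
      inner (shift_adj d) v + inner (out1 d) w1 - inner (out2 d) w2" for v w1 w2
    by (simp add: inner_vec_def shift_adj_def out1_def out2_def inner_add_right inner_diff_right
        inner_sum_left sum.distrib sum_subtractf inner_quat_mult_left)
  have "inner d (P *v x) = (\<Sum>i\<in>UNIV. inner (d $ i) (p i * (P *v x') $ i + y1 - s i * y2))"
    unfolding inner_vec_def step_back[OF st] ..
  then have 1: "inner d (P *v x) = inner (shift_adj d) (P *v x') + inner (out1 d) y1 - inner (out2 d) y2"
    unfolding pair .
  have "inner d (P *v b) = (\<Sum>i\<in>UNIV. inner (d $ i) (p i * (P *v b) $ i + u1 - s i * u2))"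
  proof -
    have "(P *v b) $ i = p i * (P *v b) $ i + u1 - s i * u2" for i
      using b[of i] by (simp add: left_diff_distrib algebra_simps)
    then show ?thesis
      unfolding inner_vec_def by (intro sum.cong refl) (rule arg_cong)
  qed
  then have 2: "inner d (P *v b) = inner (shift_adj d) (P *v b) + inner (out1 d) u1 - inner (out2 d) u2"
    unfolding pair .
  have sym: "inner b (P *v z) = inner z (P *v b)" for z
    using P_sym[of b z] inner_commute[of "P *v b" z] by simp
  show ?thesis
    using 1 2 sym[of d] sym[of "shift_adj d"] inner_commute[of "out1 d" u1] inner_commute[of "out2 d" u2]
    unfolding power2_norm_eq_inner y1 y2 x x' P_add inner_add_left inner_add_right by linarith
qed

definition coeff_vec :: "('n \<Rightarrow> quat fps) \<Rightarrow> nat \<Rightarrow> quat ^ 'n" where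
  "coeff_vec x n = (\<chi> i. fps_nth (x i) n)"

text \<open>A whole trajectory in generating functions: coefficient n is the signal at time n, and
  the factor \<open>fps_X\<close> encodes both the time shift and the initial state 0.\<close>

definition pick_system ::
  "('n \<Rightarrow> quat fps) \<Rightarrow> ('n \<Rightarrow> quat fps) \<Rightarrow> quat fps \<Rightarrow> quat fps \<Rightarrow> quat fps \<Rightarrow> quat fps \<Rightarrow> bool" where
  "pick_system x b u1 u2 y1 y2 \<longleftrightarrow>
     (\<forall>i. x i = fps_X * (fps_const (qcnj (p i)) * (x i - b i) + b i)) \<and>
     y1 = (\<Sum>i\<in>UNIV. x i - b i) + u1 \<and>
     y2 = (\<Sum>i\<in>UNIV. fps_const (qcnj (s i)) * (x i - b i)) + u2 \<and>
     (\<forall>i. fps_const (1 - p i) * (\<Sum>j\<in>UNIV. fps_const (P $ i $ j) * b j) = u1 - fps_const (s i) * u2)"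

text \<open>All system constants multiply from the left and \<open>fps_X\<close> is central, so
  right multiplication by g maps trajectories to trajectories.\<close>

lemma pick_system_mult:
  assumes "pick_system x b u1 u2 y1 y2"
  shows "pick_system (\<lambda>i. x i * g) (\<lambda>i. b i * g) (u1 * g) (u2 * g) (y1 * g) (y2 * g)"
proof -
  have x: "x i = fps_X * (fps_const (qcnj (p i)) * (x i - b i) + b i)"
    and b: "fps_const (1 - p i) * (\<Sum>j\<in>UNIV. fps_const (P $ i $ j) * b j) = u1 - fps_const (s i) * u2" for i
    using assms by (auto simp: pick_system_def)
  have "x i * g = fps_X * (fps_const (qcnj (p i)) * (x i * g - b i * g) + b i * g)" for i
    by (subst x) (simp add: algebra_simps)
  moreover have "fps_const (1 - p i) * (\<Sum>j\<in>UNIV. fps_const (P $ i $ j) * (b j * g)) = u1 * g - fps_const (s i) * (u2 * g)" for i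
  proof -
    have "fps_const (1 - p i) * (\<Sum>j\<in>UNIV. fps_const (P $ i $ j) * b j) * g = (u1 - fps_const (s i) * u2) * g"
      by (simp only: b)
    then show ?thesis
      by (simp add: mult.assoc sum_distrib_right left_diff_distrib)
  qed
  ultimately show ?thesis
    using assms unfolding pick_system_def
    by (simp add: mult.assoc sum_distrib_right left_diff_distrib distrib_right)
qed

lemma pick_system_0:
  assumes "pick_system x b u1 u2 y1 y2"
  shows "coeff_vec x 0 = 0"
proof -
  have "fps_nth (x i) 0 = 0" for i
  proof -
    have "x i = fps_X * (fps_const (qcnj (p i)) * (x i - b i) + b i)"
      using assms by (auto simp: pick_system_def)
    from arg_cong[OF this, of "\<lambda>f. fps_nth f 0"] show ?thesis
      by simp
  qed
  then show ?thesis
    by (simp add: coeff_vec_def vec_eq_iff)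
qed

lemma pick_system_step:
  assumes "pick_system x b u1 u2 y1 y2"
  shows "step (coeff_vec x n) (coeff_vec b n) (coeff_vec x (Suc n)) (fps_nth u1 n) (fps_nth u2 n)
    (fps_nth y1 n) (fps_nth y2 n)"
proof -
  have x: "x i = fps_X * (fps_const (qcnj (p i)) * (x i - b i) + b i)"
    and b: "fps_const (1 - p i) * (\<Sum>j\<in>UNIV. fps_const (P $ i $ j) * b j) = u1 - fps_const (s i) * u2"
    and y1: "y1 = (\<Sum>i\<in>UNIV. x i - b i) + u1"
    and y2: "y2 = (\<Sum>i\<in>UNIV. fps_const (qcnj (s i)) * (x i - b i)) + u2" for i
    using assms by (auto simp: pick_system_def)
  have "coeff_vec x (Suc n) = shift_adj (coeff_vec x n - coeff_vec b n) + coeff_vec b n"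
    using arg_cong[OF x, of "\<lambda>f. fps_nth f (Suc n)"]
    by (simp add: vec_eq_iff coeff_vec_def shift_adj_def)
  moreover have "(1 - p i) * (P *v coeff_vec b n) $ i = fps_nth u1 n - s i * fps_nth u2 n" for i
    using arg_cong[OF b, of "\<lambda>f. fps_nth f n" i]
    by (simp add: coeff_vec_def matrix_vector_mult_nth fps_sum_nth)
  moreover have "fps_nth y1 n = out1 (coeff_vec x n - coeff_vec b n) + fps_nth u1 n"
    "fps_nth y2 n = out2 (coeff_vec x n - coeff_vec b n) + fps_nth u2 n"
    unfolding y1 y2 by (simp_all add: out1_def out2_def coeff_vec_def fps_sum_nth)
  ultimately show ?thesis
    by (simp add: step_def)
qed

lemma pick_system_energy:
  assumes "pick_system x b u1 u2 y1 y2"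
  shows "inner (coeff_vec x N) (P *v coeff_vec x N) + (\<Sum>n<N. (norm (fps_nth y1 n))\<^sup>2)
      - (\<Sum>n<N. (norm (fps_nth y2 n))\<^sup>2)
    = (\<Sum>n<N. (norm (fps_nth u1 n))\<^sup>2) - (\<Sum>n<N. (norm (fps_nth u2 n))\<^sup>2)"
proof (induction N)
  case 0
  show ?case
    using pick_system_0[OF assms] by simp
next
  case (Suc N)
  then show ?case
    using step_energy[OF pick_system_step[OF assms, of N]] by simp
qed

lemma pick_system_back:
  assumes "pick_system x b u1 u2 y1 y2"
  shows "(P *v coeff_vec x N) $ i =
    p i ^ M * (P *v coeff_vec x (N + M)) $ i
      + (\<Sum>m<M. p i ^ m * (fps_nth y1 (N + m) - s i * fps_nth y2 (N + m)))"
proof (induction M)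
  case (Suc M)
  have "(P *v coeff_vec x (N + M)) $ i = p i * (P *v coeff_vec x (Suc (N + M))) $ i
      + fps_nth y1 (N + M) - s i * fps_nth y2 (N + M)"
    by (rule step_back[OF pick_system_step[OF assms]])
  then have "p i ^ M * (P *v coeff_vec x (N + M)) $ i = p i ^ M * (p i * (P *v coeff_vec x (Suc (N + M))) $ i
      + fps_nth y1 (N + M) - s i * fps_nth y2 (N + M))"
    by simp
  then have "p i ^ M * (P *v coeff_vec x (N + M)) $ i = p i ^ Suc M * (P *v coeff_vec x (N + Suc M)) $ i
      + p i ^ M * (fps_nth y1 (N + M) - s i * fps_nth y2 (N + M))"
    unfolding power_Suc2 by (simp add: algebra_simps)
  then show ?case
    using Suc.IH by simp
qed simp

lemma one_minus_p_nonzero: "1 - p i \<noteq> 0"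
  using p_less[of i] by (metis eq_iff_diff_eq_0 less_irrefl norm_one)

end

text \<open>The right inverse g has a right inverse h in turn, and f = f g h = h makes g
  two-sided.\<close>

lemma fps_right_inverse_exists:
  fixes f :: "quat fps"
  assumes "fps_nth f 0 \<noteq> 0"
  obtains g where "f * g = 1" "g * f = 1"
proof -
  define g where "g = fps_right_inverse f (inverse (fps_nth f 0))"
  have fg: "f * g = 1"
    unfolding g_def by (rule fps_right_inverse) (use assms in simp)
  then have "fps_nth g 0 \<noteq> 0"
    by (metis fps_mult_nth_0 fps_one_nth mult_zero_right zero_neq_one)
  define h where "h = fps_right_inverse g (inverse (fps_nth g 0))"
  have gh: "g * h = 1"
    unfolding h_def by (rule fps_right_inverse) (use \<open>fps_nth g 0 \<noteq> 0\<close> in simp)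
  have "f = f * (g * h)"
    by (simp add: gh)
  also have "\<dots> = h"
    by (simp add: fg flip: mult.assoc)
  finally show ?thesis
    using that fg gh by simp
qed

context pick_problem
begin

section \<open>Recovering inputs from outputs and consecutive states\<close>

definition back_input :: "quat ^ 'n \<Rightarrow> quat ^ 'n" where
  "back_input x = (\<chi> i. inverse (1 - qcnj (p i)) * x $ i)"

lemma one_minus_qcnj_p_nonzero: "1 - qcnj (p i) \<noteq> 0"
  using one_minus_p_nonzero[of i] qcnj_eq_0_iff[of "1 - p i"] by simp

text \<open>The step equation gives x - x' = (x - b) - T^* (x - b), and \<open>back_input\<close>
  inverts I - T^* here.\<close>

lemma step_state_diff:
  assumes "step x b x' u1 u2 y1 y2"
  shows "x - b = back_input (x - x')"
proof -
  have "x' = shift_adj (x - b) + b"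
    using assms by (simp only: step_def)
  then have "x $ i - x' $ i = (1 - qcnj (p i)) * (x $ i - b $ i)" for i
    by (simp add: shift_adj_def algebra_simps)
  then have "back_input (x - x') $ i = (x - b) $ i" for i
    using one_minus_qcnj_p_nonzero[of i] by (simp add: back_input_def flip: mult.assoc)
  then show ?thesis
    by (simp add: vec_eq_iff)
qed

lemma step_inputs:
  assumes "step x b x' u1 u2 y1 y2"
  shows "u1 = y1 - out1 (back_input (x - x'))" "u2 = y2 - out2 (back_input (x - x'))"
  using assms step_state_diff[OF assms] by (auto simp: step_def)

text \<open>With x - b = d fixed by the two states, subtracting \<open>stein_vec\<close> for d from
  the recursion leaves (I - T) P b = E u_1 - N u_2, so the inputs computed from the outputs are
  consistent.\<close>

lemma step_of_back:
  assumes bk: "\<And>i. (P *v x) $ i = p i * (P *v x') $ i + y1 - s i * y2"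
  shows "step x (x - back_input (x - x')) x' (y1 - out1 (back_input (x - x'))) (y2 - out2 (back_input (x - x'))) y1 y2"
proof -
  define d where "d = back_input (x - x')"
  define b where "b = x - d"
  have "(1 - qcnj (p i)) * d $ i = x $ i - x' $ i" for i
    using one_minus_qcnj_p_nonzero[of i] by (simp add: d_def back_input_def flip: mult.assoc)
  then have "x' $ i = (shift_adj d + b) $ i" for i
    by (simp add: shift_adj_def b_def algebra_simps)
  then have x': "x' = shift_adj d + b"
    by (simp add: vec_eq_iff)
  have "(1 - p i) * (P *v b) $ i = y1 - out1 d - s i * (y2 - out2 d)" for i
  proof -
    have "(P *v b) $ i = (P *v x) $ i - (P *v d) $ i"
      by (simp add: b_def P_diff)
    also have "\<dots> = p i * (P *v b) $ i + (y1 - out1 d - s i * (y2 - out2 d))"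
      unfolding bk[of i] stein_vec[of d i] x' P_add by (simp add: algebra_simps)
    finally show ?thesis
      by (simp add: left_diff_distrib diff_eq_eq add.commute)
  qed
  moreover have "x - b = d"
    by (simp add: b_def)
  ultimately show ?thesis
    unfolding d_def[symmetric] b_def[symmetric] step_def using x' by simp
qed

lemma P_eq_0_imp: "P *v x = 0 \<Longrightarrow> x = 0"
  using pos_definite_inner_pos[OF pos, of x] by force

lemma step_unique_b:
  assumes "step x b x' u1 u2 y1 y2" "step z c z' u1 u2 w1 w2"
  shows "b = c"
proof -
  have "(1 - p i) * (P *v b) $ i = (1 - p i) * (P *v c) $ i" for i
    using assms by (simp add: step_def)
  then have "P *v (b - c) = 0"
    using one_minus_p_nonzero by (simp add: P_diff vec_eq_iff)
  then show ?thesis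
    using P_eq_0_imp by force
qed

text \<open>The inputs fix b, because I - T and P are injective, and then the states and outputs
  forward from x_0 = 0.\<close>

lemma pick_system_unique:
  assumes "pick_system x b u1 u2 y1 y2" "pick_system z c u1 u2 w1 w2"
  shows "y1 = w1" "y2 = w2"
proof -
  note st = pick_system_step[OF assms(1)] pick_system_step[OF assms(2)]
  have b: "coeff_vec b n = coeff_vec c n" for n
    by (rule step_unique_b[OF st])
  have x: "coeff_vec x n = coeff_vec z n" for n
  proof (induction n)
    case 0
    show ?case
      using assms[THEN pick_system_0] by simp
  next
    case (Suc n)
    then show ?case
      using st[of n] b[of n] by (simp add: step_def)
  qed
  show "y1 = w1" "y2 = w2"
    using st b x by (auto simp: fps_eq_iff step_def)
qed

lemma pick_systemI:
  assumes 0: "coeff_vec x 0 = 0"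
    and st: "\<And>n. step (coeff_vec x n) (coeff_vec b n) (coeff_vec x (Suc n)) (fps_nth u1 n) (fps_nth u2 n)
      (fps_nth y1 n) (fps_nth y2 n)"
  shows "pick_system x b u1 u2 y1 y2"
  unfolding pick_system_def
proof (intro conjI allI)
  fix i
  show "x i = fps_X * (fps_const (qcnj (p i)) * (x i - b i) + b i)"
  proof (rule fps_ext)
    fix n
    show "fps_nth (x i) n = fps_nth (fps_X * (fps_const (qcnj (p i)) * (x i - b i) + b i)) n"
    proof (cases n)
      case 0
      then show ?thesis
        using assms(1) by (simp add: coeff_vec_def vec_eq_iff)
    next
      case (Suc m)
      then show ?thesis
        using st[of m] by (simp add: step_def coeff_vec_def shift_adj_def vec_eq_iff)
    qed
  qed
  show "fps_const (1 - p i) * (\<Sum>j\<in>UNIV. fps_const (P $ i $ j) * b j) = u1 - fps_const (s i) * u2"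
    using st by (simp add: fps_eq_iff fps_sum_nth step_def matrix_vector_mult_nth coeff_vec_def)
next
  show "y1 = (\<Sum>i\<in>UNIV. x i - b i) + u1" "y2 = (\<Sum>i\<in>UNIV. fps_const (qcnj (s i)) * (x i - b i)) + u2"
    using st by (auto simp: fps_eq_iff fps_sum_nth step_def coeff_vec_def out1_def out2_def)
qed

section \<open>The resolvent matrix as transfer function of the system\<close>

definition row_coeff :: "2 \<Rightarrow> 'n \<Rightarrow> quat" where
  "row_coeff a i = (if a = 1 then 1 else qcnj (s i))"

text \<open>The columns of (I - T)^{-1} [E, -N]; \<open>row_coeff\<close> lists the rows E^* and
  N^*, and \<open>theta_core\<close> is the series in the resolvent matrix before the factor p -
  1.\<close>

definition col_coeff :: "2 \<Rightarrow> quat ^ 'n" where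
  "col_coeff b = (\<chi> j. inverse (1 - p j) * (if b = 1 then 1 else - s j))"

definition geo :: "'n \<Rightarrow> quat fps" where
  "geo i = Abs_fps (\<lambda>k. qcnj (p i) ^ k)"

definition theta_core :: "2 \<Rightarrow> 2 \<Rightarrow> quat fps" where
  "theta_core a b = (\<Sum>i\<in>UNIV. fps_const (row_coeff a i) * geo i * fps_const ((matrix_inv P *v col_coeff b) $ i))"

definition theta_fps :: "2 \<Rightarrow> 2 \<Rightarrow> quat fps" where
  "theta_fps a b = (if a = b then 1 else 0) + (fps_X - 1) * theta_core a b"

lemma geo_rec: "geo i = 1 + fps_X * fps_const (qcnj (p i)) * geo i"
proof (rule fps_ext)
  fix n show "fps_nth (geo i) n = fps_nth (1 + fps_X * fps_const (qcnj (p i)) * geo i) n"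
    by (cases n) (simp_all add: geo_def mult.assoc)
qed

lemma P_matrix_inv: "P *v (matrix_inv P *v v) = v"
  by (simp add: matrix_vector_mul_assoc pos_definite_inverse[OF pos])

text \<open>The trajectory is explicit: b = P^{-1} (I - T)^{-1} (E u_1 - N u_2), d is (X - 1) times
  the geometric series in X T^* applied to b, and x = d + b. The state equation then reduces to
  \<open>geo_rec\<close>.\<close>

lemma pick_system_theta:
  "\<exists>x b. pick_system x b u1 u2 (theta_fps 1 1 * u1 + theta_fps 1 2 * u2) (theta_fps 2 1 * u1 + theta_fps 2 2 * u2)"
proof -
  define g where "g c i = fps_const ((matrix_inv P *v col_coeff c) $ i)" for c i
  define b where "b i = g 1 i * u1 + g 2 i * u2" for i
  define d where "d i = (fps_X - 1) * (geo i * b i)" for i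
  define x where "x i = d i + b i" for i
  have comm: "(fps_X - 1) * a = a * (fps_X - 1)" for a :: "quat fps"
    using fps_mult_fps_X_commute[of a] by (simp add: left_diff_distrib right_diff_distrib)
  have sum_eq: "(\<Sum>i\<in>UNIV. fps_const (row_coeff a i) * d i) = (fps_X - 1) * theta_core a 1 * u1 + (fps_X - 1) * theta_core a 2 * u2"
    for a
  proof -
    have "fps_const (row_coeff a i) * d i = (fps_X - 1) * ((fps_const (row_coeff a i) * geo i * g 1 i) * u1)
        + (fps_X - 1) * ((fps_const (row_coeff a i) * geo i * g 2 i) * u2)" for i
    proof -
      have "fps_const (row_coeff a i) * d i = (fps_X - 1) * fps_const (row_coeff a i) * (geo i * b i)"
        unfolding comm[of "fps_const _"] d_def by (simp only: mult.assoc)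
      then show ?thesis
        by (simp add: b_def distrib_left mult.assoc)
    qed
    then show ?thesis
      by (simp add: theta_core_def g_def sum.distrib sum_distrib_left sum_distrib_right mult.assoc)
  qed
  have d_eq: "d i = fps_X * (fps_const (qcnj (p i)) * d i) + (fps_X - 1) * b i" for i
  proof -
    have "d i = (fps_X - 1) * ((1 + fps_X * fps_const (qcnj (p i)) * geo i) * b i)"
      unfolding d_def using geo_rec[of i] by simp
    also have "\<dots> = (fps_X - 1) * b i + (fps_X - 1) * (fps_X * fps_const (qcnj (p i))) * (geo i * b i)"
      by (simp add: distrib_left distrib_right mult.assoc)
    also have "(fps_X - 1) * (fps_X * fps_const (qcnj (p i))) = fps_X * fps_const (qcnj (p i)) * (fps_X - 1)"
      by (rule comm)
    finally show ?thesis
      by (simp add: d_def mult.assoc add.commute)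
  qed
  have "pick_system x b u1 u2 (theta_fps 1 1 * u1 + theta_fps 1 2 * u2) (theta_fps 2 1 * u1 + theta_fps 2 2 * u2)"
    unfolding pick_system_def
  proof (intro conjI allI)
    fix i
    have "x i = fps_X * (fps_const (qcnj (p i)) * d i) + (fps_X - 1) * b i + b i"
      unfolding x_def using d_eq[of i] by simp
    moreover have "x i - b i = d i"
      by (simp add: x_def)
    ultimately show "x i = fps_X * (fps_const (qcnj (p i)) * (x i - b i) + b i)"
      by (simp add: left_diff_distrib distrib_left)
    have "(\<Sum>j\<in>UNIV. fps_const (P $ i $ j) * b j) =
        fps_const ((P *v (matrix_inv P *v col_coeff 1)) $ i) * u1 +
        fps_const ((P *v (matrix_inv P *v col_coeff 2)) $ i) * u2"
      unfolding matrix_vector_mult_nth[of P]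
      by (simp add: b_def g_def fps_eq_iff fps_sum_nth distrib_left sum.distrib sum_distrib_right mult.assoc)
    then show "fps_const (1 - p i) * (\<Sum>j\<in>UNIV. fps_const (P $ i $ j) * b j) = u1 - fps_const (s i) * u2"
      using one_minus_p_nonzero[of i]
      by (simp add: P_matrix_inv col_coeff_def distrib_left right_diff_distrib mult.assoc[symmetric] flip: fps_const_neg)
  next
    show "theta_fps 1 1 * u1 + theta_fps 1 2 * u2 = (\<Sum>i\<in>UNIV. x i - b i) + u1"
      using sum_eq[of 1] by (simp add: x_def theta_fps_def row_coeff_def distrib_right)
    show "theta_fps 2 1 * u1 + theta_fps 2 2 * u2 = (\<Sum>i\<in>UNIV. fps_const (qcnj (s i)) * (x i - b i)) + u2"
      using sum_eq[of 2] by (simp add: x_def theta_fps_def row_coeff_def distrib_right)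
  qed
  then show ?thesis
    by blast
qed

lemma qconv_theta_core: "qconv (theta_core a b)"
proof (rule qconv_bounded)
  fix n
  show "norm (fps_nth (theta_core a b) n) \<le>
      (\<Sum>i\<in>UNIV. norm (row_coeff a i) * norm ((matrix_inv P *v col_coeff b) $ i))"
    unfolding theta_core_def fps_sum_nth
  proof (rule order_trans[OF norm_sum], rule sum_mono)
    fix i
    have "norm (p i) ^ n \<le> 1"
      using p_less[of i] by (intro power_le_one) auto
    then show "norm (fps_nth (fps_const (row_coeff a i) * geo i * fps_const ((matrix_inv P *v col_coeff b) $ i)) n)
        \<le> norm (row_coeff a i) * norm ((matrix_inv P *v col_coeff b) $ i)"
      by (simp add: geo_def norm_mult norm_power mult_right_mono mult_left_le)
  qed
qed

section \<open>Power series of the entries of \<open>Theta\<close>\<close>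

lemma diag_mat_mult_left: "(diag_mat c ** A) $ i $ j = c i * A $ i $ j"
proof -
  have "(diag_mat c ** A) $ i $ j = (\<Sum>k\<in>UNIV. if k = i then c i * A $ k $ j else 0)"
    unfolding matrix_matrix_mult_def diag_mat_def vec_lambda_beta by (intro sum.cong refl) auto
  then show ?thesis
    by simp
qed

lemma diag_mat_mult_right: "(A ** diag_mat c) $ i $ j = A $ i $ j * c j"
proof -
  have "(A ** diag_mat c) $ i $ j = (\<Sum>k\<in>UNIV. if k = j then A $ i $ k * c j else 0)"
    unfolding matrix_matrix_mult_def diag_mat_def vec_lambda_beta by (intro sum.cong refl) auto
  then show ?thesis
    by simp
qed

lemma diag_mat_inverse: "matrix_inv (mat 1 - diag_mat p) = diag_mat (\<lambda>i. inverse (1 - p i))"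
proof -
  define A where "A = mat 1 - diag_mat p"
  define B where "B = diag_mat (\<lambda>i. inverse (1 - p i))"
  have A: "A = diag_mat (\<lambda>i. 1 - p i)"
    by (auto simp: A_def diag_mat_def mat_def vec_eq_iff)
  have mult: "diag_mat c ** diag_mat d = diag_mat (\<lambda>i. c i * d i)" for c d :: "'n \<Rightarrow> quat"
    by (simp add: vec_eq_iff diag_mat_mult_left) (simp add: diag_mat_def)
  have AB: "A ** B = mat 1" "B ** A = mat 1"
    using one_minus_p_nonzero by (auto simp: A B_def mult) (auto simp: diag_mat_def mat_def)
  then have "\<exists>C. A ** C = mat 1 \<and> C ** A = mat 1"
    by blast
  from someI_ex[OF this] have inv: "A ** matrix_inv A = mat 1"
    by (simp add: matrix_inv_def)
  have "matrix_inv A = (B ** A) ** matrix_inv A"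
    by (simp add: AB)
  also have "\<dots> = B"
    by (simp add: inv flip: matrix_mul_assoc)
  finally show ?thesis
    by (simp add: A_def B_def)
qed

lemma mat_pow_diag: "mat_pow (ctranspose (diag_mat p)) k = diag_mat (\<lambda>i. qcnj (p i) ^ k)"
proof (induction k)
  case (Suc k)
  show ?case
    unfolding mat_pow.simps Suc.IH
    by (simp add: vec_eq_iff diag_mat_mult_right) (simp add: diag_mat_def ctranspose_def)
qed (simp add: diag_mat_def mat_def)

lemma Theta_term:
  "(ctranspose (two_cols (\<chi> i. 1) (\<chi> i. s i)) ** mat_pow (ctranspose (diag_mat p)) k ** matrix_inv P
      ** matrix_inv (mat 1 - diag_mat p) ** two_cols (\<chi> i. 1) (- (\<chi> i. s i))) $ a $ b
    = fps_nth (theta_core a b) k"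
proof -
  let ?C = "ctranspose (two_cols (\<chi> i. 1) (\<chi> i. s i))"
  let ?N = "two_cols (\<chi> i. (1 :: quat)) (- (\<chi> i. s i))"
  have row: "?C $ a $ i = row_coeff a i" for i
    using exhaust_2[of a] by (auto simp: ctranspose_def two_cols_def transpose_def row_coeff_def)
  have "(diag_mat (\<lambda>i. inverse (1 - p i)) ** ?N) $ j $ b = col_coeff b $ j" for j
  proof -
    have "?N $ j $ b = (if b = 1 then 1 else - s j)"
      using exhaust_2[of b] by (auto simp: two_cols_def transpose_def)
    then show ?thesis
      by (simp add: diag_mat_mult_left col_coeff_def)
  qed
  then have right: "(matrix_inv P ** (diag_mat (\<lambda>i. inverse (1 - p i)) ** ?N)) $ i $ b
      = (matrix_inv P *v col_coeff b) $ i" for i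
    by (simp add: matrix_matrix_mult_def matrix_vector_mult_nth)
  have left: "(?C ** diag_mat (\<lambda>i. qcnj (p i) ^ k)) $ a $ i = row_coeff a i * qcnj (p i) ^ k" for i
    by (simp add: diag_mat_mult_right row)
  have "(?C ** mat_pow (ctranspose (diag_mat p)) k ** matrix_inv P
      ** matrix_inv (mat 1 - diag_mat p) ** ?N) $ a $ b
    = ((?C ** diag_mat (\<lambda>i. qcnj (p i) ^ k)) ** (matrix_inv P ** (diag_mat (\<lambda>i. inverse (1 - p i)) ** ?N))) $ a $ b"
    by (simp only: mat_pow_diag diag_mat_inverse matrix_mul_assoc)
  also have "\<dots> = (\<Sum>i\<in>UNIV. row_coeff a i * qcnj (p i) ^ k * (matrix_inv P *v col_coeff b) $ i)"
    by (subst matrix_matrix_mult_def) (simp add: left right)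
  finally show ?thesis
    by (simp add: theta_core_def fps_sum_nth geo_def)
qed

lemma Theta_entry:
  assumes q: "q \<in> ball 0 1"
  shows "Theta p s q $ a $ b = (if a = b then 1 else 0) + (q * qeval (theta_core a b) q - qeval (theta_core a b) q)"
proof -
  let ?M = "\<lambda>k. ctranspose (two_cols (\<chi> i. 1) (\<chi> i. s i)) ** mat_pow (ctranspose (diag_mat p)) k ** matrix_inv P
      ** matrix_inv (mat 1 - diag_mat p) ** two_cols (\<chi> i. 1) (- (\<chi> i. s i))"
  have "(\<lambda>k. lscale (q ^ k) (?M k)) sums (\<chi> a b. qeval (theta_core a b) q)"
    unfolding sums_def
  proof (intro vec_tendstoI)
    fix a b
    have "(\<lambda>k. q ^ k * fps_nth (theta_core a b) k) sums qeval (theta_core a b) q"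
      using has_qps_qeval[OF qconv_theta_core] q by (auto simp: has_qps_def)
    then show "(\<lambda>n. (\<Sum>k<n. lscale (q ^ k) (?M k)) $ a $ b) \<longlonglongrightarrow> (\<chi> a b. qeval (theta_core a b) q) $ a $ b"
      by (simp add: sums_def lscale_def Theta_term)
  qed
  then have "(\<Sum>k. lscale (q ^ k) (?M k)) = (\<chi> a b. qeval (theta_core a b) q)"
    by (rule sums_unique[symmetric])
  then show ?thesis
    by (simp add: Theta_def Let_def lscale_def mat_def left_diff_distrib)
qed

lemma has_qps_Theta: "has_qps (\<lambda>q. Theta p s q $ a $ b) (theta_fps a b)"
proof -
  define C where "C = theta_core a b"
  have "has_qps (\<lambda>q. q * qeval C q - qeval C q) (fps_X * C - C)"
    unfolding C_def by (intro has_qps_diff has_qps_X_mult has_qps_qeval qconv_theta_core)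
  moreover have "has_qps (\<lambda>q. if a = b then 1 else 0) (if a = b then 1 else 0)"
    using has_qps_0 has_qps_1 by simp
  ultimately have "has_qps (\<lambda>q. (if a = b then 1 else 0) + (q * qeval C q - qeval C q))
      ((if a = b then 1 else 0) + (fps_X * C - C))"
    by (rule has_qps_add[rotated])
  then have "has_qps (\<lambda>q. (if a = b then 1 else 0) + (q * qeval C q - qeval C q)) (theta_fps a b)"
    by (simp add: theta_fps_def left_diff_distrib C_def)
  then show ?thesis
    by (rule has_qps_cong) (simp add: Theta_entry C_def)
qed

section \<open>From a parameter to a solution\<close>

definition num :: "quat fps \<Rightarrow> quat fps" where "num e = theta_fps 1 1 * e + theta_fps 1 2"

definition den :: "quat fps \<Rightarrow> quat fps" where "den e = theta_fps 2 1 * e + theta_fps 2 2"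

text \<open>Inputs are tied by u_1 = e * u_2. Leaving g free allows the second output
  \<open>den e * g\<close> to be prescribed once the denominator is inverted.\<close>

lemma pick_system_num_den: "\<exists>x b. pick_system x b (e * g) g (num e * g) (den e * g)"
proof -
  obtain x b where "pick_system x b (e * g) g (theta_fps 1 1 * (e * g) + theta_fps 1 2 * g) (theta_fps 2 1 * (e * g) + theta_fps 2 2 * g)"
    using pick_system_theta by blast
  then have "pick_system x b (e * g) g (num e * g) (den e * g)"
    by (simp add: num_def den_def distrib_right mult.assoc)
  then show ?thesis
    by blast
qed

text \<open>If the second output vanishes at time 0 for g = 1, the energy of the first step is at
  most |e_0|^2 - 1 \<le> 0, so x_1 = 0 = x_0. Then \<open>step_inputs\<close> returns the second
  input 1 as 0.\<close>

lemma den_nonzero: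
  assumes e: "schur_fps e"
  shows "fps_nth (den e) 0 \<noteq> 0"
proof
  assume den0: "fps_nth (den e) 0 = 0"
  obtain x b where sys: "pick_system x b (e * 1) 1 (num e * 1) (den e * 1)"
    using pick_system_num_den[of e 1] by blast
  have "norm (fps_nth e 0) \<le> 1"
    by (rule schur_fps_coeff_le[OF e])
  then have "(norm (fps_nth e 0))\<^sup>2 \<le> 1"
    by (simp add: power_le_one)
  then have le: "inner (coeff_vec x 1) (P *v coeff_vec x 1) + (norm (fps_nth (num e) 0))\<^sup>2 \<le> 0"
    using pick_system_energy[OF sys, of 1] den0 by simp
  then have "inner (coeff_vec x 1) (P *v coeff_vec x 1) \<le> 0"
    using zero_le_power2[of "norm (fps_nth (num e) 0)"] by linarith
  then have x1: "coeff_vec x 1 = 0"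
    using pos_definite_inner_pos[OF pos, of "coeff_vec x 1"] by fastforce
  have "out2 0 = 0"
    by (simp add: out2_def)
  moreover have "back_input 0 = 0"
    by (simp add: back_input_def vec_eq_iff)
  ultimately have "fps_nth (1 :: quat fps) 0 = 0"
    using step_inputs(2)[OF pick_system_step[OF sys, of 0]] pick_system_0[OF sys] x1 den0 by simp
  then show False
    by simp
qed

lemma bounded_of_energy:
  "\<exists>K. \<forall>x :: quat ^ 'n. inner x (P *v x) \<le> 1 \<longrightarrow> norm x \<le> K"
proof -
  obtain K where K: "K \<ge> 0" "\<forall>x. (norm x)\<^sup>2 \<le> K * inner x (P *v x)"
    using pos_definite_coercive[OF pos] by blast
  have "norm x \<le> sqrt K" if "inner x (P *v x) \<le> 1" for x
  proof -
    have "(norm x)\<^sup>2 \<le> K"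
      using K(2)[rule_format, of x] mult_left_mono[OF that K(1)] by simp
    then show ?thesis
      by (rule real_le_rsqrt)
  qed
  then show ?thesis
    by blast
qed

lemma bounded_out2_back_input: "\<exists>C. \<forall>x. norm (out2 (back_input x)) \<le> C * norm x"
proof (intro exI allI)
  fix x
  have "norm (out2 (back_input x)) \<le> (\<Sum>i\<in>UNIV. norm (qcnj (s i)) * (norm (inverse (1 - qcnj (p i))) * norm x))"
    unfolding out2_def
  proof (rule order_trans[OF norm_sum], rule sum_mono)
    fix i
    show "norm (qcnj (s i) * back_input x $ i) \<le> norm (qcnj (s i)) * (norm (inverse (1 - qcnj (p i))) * norm x)"
      using Finite_Cartesian_Product.norm_nth_le[of x i] by (simp add: back_input_def norm_mult mult_left_mono)
  qed
  then show "norm (out2 (back_input x)) \<le> (\<Sum>i\<in>UNIV. norm (qcnj (s i)) * norm (inverse (1 - qcnj (p i)))) * norm x"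
    by (simp only: sum_distrib_right mult.assoc)
qed

lemma parametrized_solution:
  assumes e: "schur_fps e"
  shows "\<exists>g. den e * g = 1 \<and> g * den e = 1 \<and> qconv g \<and> schur_fps (num e * g) \<and>
    (\<forall>i. (\<lambda>m. p i ^ m * fps_nth (num e * g) m) sums s i)"
proof -
  obtain g where g: "den e * g = 1" "g * den e = 1"
    using fps_right_inverse_exists[OF den_nonzero[OF e]] .
  define S where "S = num e * g"
  \<comment> \<open>Driving the system with g * h makes its second output equal to h, so the energy
    balance speaks directly about S * h against h.\<close>
  have energy: "\<exists>x b. pick_system x b (e * (g * h)) (g * h) (S * h) h \<and>
      (\<forall>N. inner (coeff_vec x N) (P *v coeff_vec x N) + (\<Sum>n<N. (norm (fps_nth (S * h) n))\<^sup>2)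
        \<le> (\<Sum>n<N. (norm (fps_nth h n))\<^sup>2))" for h
  proof -
    have "den e * (g * h) = h"
      using g by (simp flip: mult.assoc)
    then obtain x b where sys: "pick_system x b (e * (g * h)) (g * h) (S * h) h"
      using pick_system_num_den[of e "g * h"] by (metis S_def mult.assoc)
    have "inner (coeff_vec x N) (P *v coeff_vec x N) + (\<Sum>n<N. (norm (fps_nth (S * h) n))\<^sup>2)
        \<le> (\<Sum>n<N. (norm (fps_nth h n))\<^sup>2)" for N
      using pick_system_energy[OF sys, of N] schur_fpsD[OF e, where h = "g * h" and N = N] by linarith
    with sys show ?thesis
      by blast
  qed
  have "schur_fps S"
    unfolding schur_fps_def
  proof (intro allI)
    fix h N
    obtain x where "inner (coeff_vec x N) (P *v coeff_vec x N) + (\<Sum>n<N. (norm (fps_nth (S * h) n))\<^sup>2)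
        \<le> (\<Sum>n<N. (norm (fps_nth h n))\<^sup>2)"
      using energy[of h] by blast
    then show "(\<Sum>n<N. (norm (fps_nth (S * h) n))\<^sup>2) \<le> (\<Sum>n<N. (norm (fps_nth h n))\<^sup>2)"
      using P_nonneg[of "coeff_vec x N"] by linarith
  qed
  obtain x b where sys: "pick_system x b (e * (g * 1)) (g * 1) (S * 1) 1"
    and le: "inner (coeff_vec x N) (P *v coeff_vec x N) + (\<Sum>n<N. (norm (fps_nth (S * 1) n))\<^sup>2)
        \<le> (\<Sum>n<N. (norm (fps_nth 1 n :: quat))\<^sup>2)" for N
    using energy[of 1] by blast
  have one: "(\<Sum>n<N. (norm (fps_nth 1 n :: quat))\<^sup>2) \<le> 1" for N
  proof -
    have "(\<Sum>n<N. (norm (fps_nth 1 n :: quat))\<^sup>2) = (\<Sum>n<N. if n = 0 then 1 else 0)"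
      by (intro sum.cong) auto
    then show ?thesis
      by simp
  qed
  have "inner (coeff_vec x N) (P *v coeff_vec x N) \<le> 1" for N
    using le[of N] one[of N] sum_nonneg[of "{..<N}" "\<lambda>n. (norm (fps_nth (S * 1) n))\<^sup>2"] by simp
  then obtain K where x_le: "norm (coeff_vec x N) \<le> K" for N
    using bounded_of_energy by blast
  obtain C where C: "\<forall>x. norm (out2 (back_input x)) \<le> C * norm x"
    using bounded_out2_back_input by blast
  \<comment> \<open>For h = 1 the second input is g itself. It differs from the output 1 by a linear
    function of two consecutive states, whose energy is at most 1; hence its coefficients are
    bounded.\<close>
  have "qconv g"
  proof (rule qconv_bounded)
    fix n
    define v where "v = coeff_vec x n - coeff_vec x (Suc n)"
    have "norm v \<le> 2 * K"
      using norm_triangle_ineq4[of "coeff_vec x n" "coeff_vec x (Suc n)"] x_le[of n] x_le[of "Suc n"]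
      by (simp add: v_def)
    then have "norm (out2 (back_input v)) \<le> \<bar>C\<bar> * (2 * K)"
      by (intro order_trans[OF spec[OF C]] mult_mono) auto
    moreover have gn: "fps_nth g n = fps_nth 1 n - out2 (back_input v)"
      using step_inputs(2)[OF pick_system_step[OF sys, of n]] by (simp add: v_def)
    moreover have "norm (fps_nth 1 n :: quat) \<le> 1"
      by simp
    ultimately show "norm (fps_nth g n) \<le> 1 + \<bar>C\<bar> * (2 * K)"
      unfolding gn using norm_triangle_ineq4[of "fps_nth 1 n" "out2 (back_input v)"] by linarith
  qed
  have "(\<lambda>m. p i ^ m * fps_nth S m) sums s i" for i
  proof -
    \<comment> \<open>Iterating the backward recursion from x_0 = 0 with second output 1, the
      partial sums miss s_i exactly by a power of p_i times a bounded sequence. \<open>Suc M\<close>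
      ensures that the constant coefficient of 1 is among the summands.\<close>
    have eq: "(\<Sum>m<Suc M. p i ^ m * fps_nth S m) = s i - p i ^ Suc M * (P *v coeff_vec x (Suc M)) $ i" for M
    proof -
      have "0 = p i ^ Suc M * (P *v coeff_vec x (Suc M)) $ i
          + (\<Sum>m<Suc M. p i ^ m * (fps_nth S m - s i * fps_nth 1 m))"
        using pick_system_back[OF sys, of 0 i "Suc M"] pick_system_0[OF sys] by simp
      also have "(\<Sum>m<Suc M. p i ^ m * (fps_nth S m - s i * fps_nth 1 m)) =
          (\<Sum>m<Suc M. p i ^ m * fps_nth S m) - (\<Sum>m<Suc M. if m = 0 then s i else 0)"
        unfolding sum_subtractf[symmetric] by (intro sum.cong) (auto simp: right_diff_distrib)
      also have "(\<Sum>m<Suc M. if m = 0 then s i else 0) = s i"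
        by (subst sum.delta) auto
      finally show ?thesis
        by (simp add: algebra_simps)
    qed
    obtain B where B: "\<And>v. norm (P *v v) \<le> B * norm v"
      using linear_bounded[OF linear_quat_matrix_vector[of P]] by blast
    have "(\<lambda>M. p i ^ Suc M * (P *v coeff_vec x (Suc M)) $ i) \<longlonglongrightarrow> 0"
    proof (rule Lim_null_comparison)
      have "norm (p i ^ Suc M * (P *v coeff_vec x (Suc M)) $ i) \<le> norm (p i) ^ Suc M * (\<bar>B\<bar> * K)" for M
      proof -
        have "norm ((P *v coeff_vec x (Suc M)) $ i) \<le> B * norm (coeff_vec x (Suc M))"
          by (rule order_trans[OF Finite_Cartesian_Product.norm_nth_le B])
        also have "\<dots> \<le> \<bar>B\<bar> * K"
          by (intro mult_mono x_le) auto
        finally show ?thesis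
          by (simp add: norm_mult norm_power mult_left_mono)
      qed
      then show "\<forall>\<^sub>F M in sequentially. norm (p i ^ Suc M * (P *v coeff_vec x (Suc M)) $ i)
          \<le> norm (p i) ^ Suc M * (\<bar>B\<bar> * K)"
        by simp
      have "(\<lambda>M. norm (p i) ^ Suc M) \<longlonglongrightarrow> 0"
        by (rule LIMSEQ_Suc[OF LIMSEQ_power_zero]) (use p_less[of i] in simp)
      then show "(\<lambda>M. norm (p i) ^ Suc M * (\<bar>B\<bar> * K)) \<longlonglongrightarrow> 0"
        by (rule tendsto_mult_left_zero)
    qed
    then have "(\<lambda>M. s i - p i ^ Suc M * (P *v coeff_vec x (Suc M)) $ i) \<longlonglongrightarrow> s i - 0"
      by (intro tendsto_diff tendsto_const)
    then have "(\<lambda>M. \<Sum>m<Suc M. p i ^ m * fps_nth S m) \<longlonglongrightarrow> s i"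
      unfolding eq by simp
    then show ?thesis
      unfolding sums_def by (rule LIMSEQ_imp_Suc)
  qed
  with g \<open>qconv g\<close> \<open>schur_fps S\<close> show ?thesis
    unfolding S_def by blast
qed

end

lemma norm_vec_le_sum: "norm (x :: 'a::real_normed_vector ^ 'n) \<le> (\<Sum>i\<in>UNIV. norm (x $ i))"
  unfolding norm_vec_def by (rule L2_set_le_sum) simp

context pick_problem
begin

section \<open>From a solution to a parameter\<close>

lemma step_pairing:
  assumes "step x b x' u1 u2 y1 y2"
  shows "inner v (P *v x) = inner (shift_adj v) (P *v x') + inner (out1 v) y1 - inner (out2 v) y2"
proof -
  have "inner v (P *v x) = (\<Sum>i\<in>UNIV. inner (v $ i) (p i * (P *v x') $ i + y1 - s i * y2))"
    unfolding inner_vec_def step_back[OF assms] ..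
  then show ?thesis
    by (simp add: inner_vec_def shift_adj_def out1_def out2_def inner_add_right inner_diff_right
        inner_sum_left sum.distrib sum_subtractf inner_quat_mult_left)
qed

text \<open>While the state runs forward, the test vector v runs under T^*; the sum pairs the free
  outputs of v with the outputs of the system.\<close>

lemma pick_system_pairing:
  assumes "pick_system x b u1 u2 y1 y2"
  shows "inner v (P *v coeff_vec x N) =
    inner ((shift_adj ^^ M) v) (P *v coeff_vec x (N + M))
      + (\<Sum>m<M. inner (out1 ((shift_adj ^^ m) v)) (fps_nth y1 (N + m))
               - inner (out2 ((shift_adj ^^ m) v)) (fps_nth y2 (N + m)))"
proof (induction M)
  case (Suc M)
  then show ?case
    using step_pairing[OF pick_system_step[OF assms, of "N + M"], of "(shift_adj ^^ M) v"] by simp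
qed simp

text \<open>The energy balance of the free motion: for zero input and b = 0 a step is v \<mapsto>
  T^* v.\<close>

lemma stein_telescope:
  "inner v (P *v v) = inner ((shift_adj ^^ M) v) (P *v (shift_adj ^^ M) v)
    + (\<Sum>m<M. (norm (out1 ((shift_adj ^^ m) v)))\<^sup>2 - (norm (out2 ((shift_adj ^^ m) v)))\<^sup>2)"
proof (induction M)
  case (Suc M)
  define w where "w = (shift_adj ^^ M) v"
  have "step w 0 (shift_adj w) 0 0 (out1 w) (out2 w)"
    by (simp add: step_def matrix_vector_mult_def vec_eq_iff)
  from step_energy[OF this] Suc.IH show ?case
    by (simp add: w_def)
qed simp

lemma shift_adj_pow_nth: "((shift_adj ^^ m) v) $ i = qcnj (p i) ^ m * v $ i"
  by (induction m) (simp_all add: shift_adj_def mult.assoc)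

lemma shift_adj_pow_tendsto_0: "(\<lambda>m. (shift_adj ^^ m) v) \<longlonglongrightarrow> 0"
proof (rule vec_tendstoI)
  fix i
  have "(\<lambda>m. qcnj (p i) ^ m * v $ i) \<longlonglongrightarrow> 0"
    by (intro tendsto_mult_left_zero LIMSEQ_power_zero) (use p_less[of i] in simp)
  then show "(\<lambda>m. (shift_adj ^^ m) v $ i) \<longlonglongrightarrow> 0 $ i"
    by (simp add: shift_adj_pow_nth)
qed

lemma summable_out2_shift_adj: "summable (\<lambda>m. norm (out2 ((shift_adj ^^ m) v)))"
proof (rule summable_comparison_test')
  show "summable (\<lambda>m. \<Sum>i\<in>UNIV. norm (s i) * norm (v $ i) * norm (p i) ^ m)"
    by (intro summable_sum summable_mult summable_geometric) (use p_less in simp)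
  fix m
  show "norm (norm (out2 ((shift_adj ^^ m) v))) \<le> (\<Sum>i\<in>UNIV. norm (s i) * norm (v $ i) * norm (p i) ^ m)"
    unfolding out2_def real_norm_def abs_norm_cancel
    by (rule order_trans[OF norm_sum]) (simp add: shift_adj_pow_nth norm_mult norm_power mult_ac)
qed

text \<open>If $w$ is the state reached at time $N$ under the input $g$, then continuing $g$ by the
  free output of $w$ is the worst future; contractivity of $S$ on this single input bounds the
  energy of $w$ by the energy dissipated so far.\<close>

lemma state_energy_le:
  assumes sys: "pick_system x b u1 u2 a 1" and a: "schur_fps a"
    and x_le: "\<forall>n. norm (coeff_vec x n) \<le> K"
  shows "inner (coeff_vec (\<lambda>i. x i * g) N) (P *v coeff_vec (\<lambda>i. x i * g) N)
    + (\<Sum>n<N. (norm (fps_nth (a * g) n))\<^sup>2) \<le> (\<Sum>n<N. (norm (fps_nth g n))\<^sup>2)"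
proof -
  define w where "w = coeff_vec (\<lambda>i. x i * g) N"
  define o1 where "o1 m = out1 ((shift_adj ^^ m) w)" for m
  define o2 where "o2 m = out2 ((shift_adj ^^ m) w)" for m
  define f where "f = Abs_fps (\<lambda>n. if n < N then fps_nth g n else o2 (n - N))"
  define X where "X = (\<lambda>i. x i * f)"
  have x0: "fps_nth (x i) 0 = 0" for i
    using pick_system_0[OF sys] by (simp add: coeff_vec_def vec_eq_iff)
  have XN: "coeff_vec X N = w"
  proof -
    \<comment> \<open>Only the term k = 0 can see the changed input at time N, and it vanishes since
      x starts at 0: the state at time N depends on the inputs before N.\<close>
    have "(\<Sum>k=0..N. fps_nth (x i) k * fps_nth f (N - k)) = (\<Sum>k=0..N. fps_nth (x i) k * fps_nth g (N - k))" for i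
    proof (intro sum.cong refl)
      fix k assume "k \<in> {0..N}"
      then show "fps_nth (x i) k * fps_nth f (N - k) = fps_nth (x i) k * fps_nth g (N - k)"
        by (cases "k = 0") (auto simp: x0 f_def)
    qed
    then show ?thesis
      by (simp add: X_def w_def coeff_vec_def fps_mult_nth)
  qed
  have aN: "fps_nth (a * f) n = fps_nth (a * g) n" if "n < N" for n
    unfolding fps_mult_nth using that by (intro sum.cong) (auto simp: f_def)
  have sysX: "pick_system X (\<lambda>i. b i * f) (u1 * f) (u2 * f) (a * f) f"
    using pick_system_mult[OF sys, of f] by (simp add: X_def)
  have o2_summable: "summable (\<lambda>m. norm (o2 m))"
    unfolding o2_def by (rule summable_out2_shift_adj)
  have "summable (\<lambda>n. norm (fps_nth f (n + N)))"
    using o2_summable by (simp add: f_def)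
  then have f_summable: "summable (\<lambda>n. norm (fps_nth f n))"
    by (rule summable_iff_shift[THEN iffD1])
  define F where "F = (\<Sum>n. norm (fps_nth f n))"
  \<comment> \<open>The convolution of the bounded states with the summable input f is
    bounded.\<close>
  have X_le: "norm (coeff_vec X n) \<le> real CARD('n) * (K * F)" for n
  proof -
    have "K \<ge> 0"
      using order_trans[OF norm_ge_zero spec[OF x_le, of 0]] .
    have "norm (fps_nth (X i) n) \<le> K * F" for i
    proof -
      have xi: "norm (fps_nth (x i) k) \<le> K" for k
        using order_trans[OF Finite_Cartesian_Product.norm_nth_le[of "coeff_vec x k" i] spec[OF x_le]] by (simp add: coeff_vec_def)
      have "norm (fps_nth (X i) n) \<le> (\<Sum>k=0..n. K * norm (fps_nth f (n - k)))"
        unfolding X_def fps_mult_nth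
        by (rule order_trans[OF norm_sum]) (auto simp: norm_mult intro!: sum_mono mult_right_mono xi)
      also have "\<dots> = K * (\<Sum>k=0..n. norm (fps_nth f (n - k)))"
        by (simp add: sum_distrib_left)
      also have "(\<Sum>k=0..n. norm (fps_nth f (n - k))) = (\<Sum>k=0..n. norm (fps_nth f k))"
        using sum.atLeastAtMost_rev[of "\<lambda>k. norm (fps_nth f k)" 0 n] by simp
      also have "\<dots> \<le> F"
        unfolding F_def by (intro sum_le_suminf f_summable) auto
      finally show ?thesis
        using \<open>K \<ge> 0\<close> by (simp add: mult_left_mono)
    qed
    then have "(\<Sum>i\<in>UNIV. norm (coeff_vec X n $ i)) \<le> (\<Sum>i\<in>(UNIV :: 'n set). K * F)"
      by (intro sum_mono) (simp add: coeff_vec_def)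
    then show ?thesis
      using norm_vec_le_sum[of "coeff_vec X n"] by simp
  qed
  \<comment> \<open>What remains at the horizon N + M; it vanishes because the free motion decays
    while the states X stay bounded.\<close>
  define eps where "eps M = inner ((shift_adj ^^ M) w) (P *v coeff_vec X (N + M))" for M
  have eps: "eps \<longlonglongrightarrow> 0"
  proof -
    obtain B where B: "\<And>v. norm (P *v v) \<le> B * norm v"
      using linear_bounded[OF linear_quat_matrix_vector[of P]] by blast
    define D where "D = \<bar>B\<bar> * (real CARD('n) * (K * F))"
    have PX_le: "norm (P *v coeff_vec X n) \<le> D" for n
    proof -
      have "norm (P *v coeff_vec X n) \<le> B * norm (coeff_vec X n)"
        by (rule B)
      also have "\<dots> \<le> D"
        unfolding D_def using X_le[of n] by (intro mult_mono) auto
      finally show ?thesis .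
    qed
    have "norm (eps M) \<le> norm ((shift_adj ^^ M) w) * D" for M
    proof -
      have "norm (eps M) \<le> norm ((shift_adj ^^ M) w) * norm (P *v coeff_vec X (N + M))"
        unfolding eps_def real_norm_def by (rule Cauchy_Schwarz_ineq2)
      also have "\<dots> \<le> norm ((shift_adj ^^ M) w) * D"
        by (intro mult_left_mono PX_le) auto
      finally show ?thesis .
    qed
    moreover have "(\<lambda>M. norm ((shift_adj ^^ M) w) * D) \<longlonglongrightarrow> 0"
      using tendsto_mult_left_zero[OF tendsto_norm_zero[OF shift_adj_pow_tendsto_0]] .
    ultimately show ?thesis
      by (intro Lim_null_comparison[of eps]) auto
  qed
  define G where "G = (\<Sum>n<N. (norm (fps_nth g n))\<^sup>2) - (\<Sum>n<N. (norm (fps_nth (a * g) n))\<^sup>2)"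
  \<comment> \<open>The pairing expresses twice the energy of w through 2 <o1, Y> \<le> |o1|^2 +
    |Y|^2 and -2 |o2|^2. By the Stein telescope the o1 terms minus one share of o2 cost at most one
    copy of the energy; contractivity bounds the Y terms minus the other share by G.\<close>
  have le: "inner w (P *v w) \<le> 2 * eps M + G" for M
  proof -
    define Y where "Y m = fps_nth (a * f) (N + m)" for m
    have "inner w (P *v w) = eps M + (\<Sum>m<M. inner (o1 m) (Y m) - (norm (o2 m))\<^sup>2)"
      using pick_system_pairing[OF sysX, of w N M]
      by (simp add: XN eps_def o1_def o2_def Y_def f_def power2_norm_eq_inner)
    then have 1: "2 * inner w (P *v w) = 2 * eps M + (\<Sum>m<M. 2 * inner (o1 m) (Y m)) - 2 * (\<Sum>m<M. (norm (o2 m))\<^sup>2)"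
      by (simp add: sum_subtractf sum_distrib_left)
    have "(\<Sum>m<M. 2 * inner (o1 m) (Y m)) \<le> (\<Sum>m<M. (norm (o1 m))\<^sup>2 + (norm (Y m))\<^sup>2)"
    proof (rule sum_mono)
      fix m
      have "0 \<le> inner (o1 m - Y m) (o1 m - Y m)"
        by simp
      then show "2 * inner (o1 m) (Y m) \<le> (norm (o1 m))\<^sup>2 + (norm (Y m))\<^sup>2"
        by (simp add: power2_norm_eq_inner inner_diff_left inner_diff_right inner_commute)
    qed
    then have 2: "(\<Sum>m<M. 2 * inner (o1 m) (Y m)) \<le> (\<Sum>m<M. (norm (o1 m))\<^sup>2) + (\<Sum>m<M. (norm (Y m))\<^sup>2)"
      by (simp add: sum.distrib)
    have 3: "(\<Sum>m<M. (norm (o1 m))\<^sup>2) - (\<Sum>m<M. (norm (o2 m))\<^sup>2) \<le> inner w (P *v w)"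
      using stein_telescope[of w M] P_nonneg[of "(shift_adj ^^ M) w"]
      by (simp add: o1_def o2_def sum_subtractf)
    have split: "(\<Sum>n<N + M. h n) = (\<Sum>n<N. h n) + (\<Sum>m<M. h (N + m))" for h :: "nat \<Rightarrow> real"
      by (induction M) simp_all
    have 4: "(\<Sum>n<N. (norm (fps_nth (a * g) n))\<^sup>2) + (\<Sum>m<M. (norm (Y m))\<^sup>2) \<le>
        (\<Sum>n<N. (norm (fps_nth g n))\<^sup>2) + (\<Sum>m<M. (norm (o2 m))\<^sup>2)"
      using schur_fpsD[OF a, where h = f and N = "N + M"] unfolding split
      by (simp add: aN Y_def) (simp add: f_def)
    show ?thesis
      using 1 2 3 4 by (simp add: G_def)
  qed
  have "(\<lambda>M. 2 * eps M + G) \<longlonglongrightarrow> 2 * 0 + G"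
    by (intro tendsto_intros eps)
  then have "inner w (P *v w) \<le> 2 * 0 + G"
    by (rule LIMSEQ_le_const) (use le in auto)
  then show ?thesis
    by (simp add: w_def G_def)
qed

lemma solution_parameter:
  assumes a: "schur_fps a" and int: "\<forall>i. (\<lambda>m. p i ^ m * fps_nth a m) sums s i"
  shows "\<exists>e u. schur_fps e \<and> a = num e * u \<and> den e * u = 1"
proof -
  define \<delta> where "\<delta> i n = fps_nth a n - s i * fps_nth 1 n" for i n
  \<comment> \<open>The intended P x_n: this tail sum solves the backward recursion for the outputs
    (a, 1) from infinity, and its vanishing at n = 0 is the interpolation condition.\<close>
  define c where "c n = (\<chi> i. \<Sum>m. p i ^ m * \<delta> i (n + m))" for n
  have \<delta>_le: "norm (\<delta> i n) \<le> 1 + norm (s i)" for i n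
  proof -
    have "norm (\<delta> i n) \<le> norm (fps_nth a n) + norm (s i * fps_nth 1 n)"
      unfolding \<delta>_def by (rule norm_triangle_ineq4)
    moreover have "norm (s i * fps_nth 1 n) \<le> norm (s i)"
      by simp
    ultimately show ?thesis
      using schur_fps_coeff_le[OF a, of n] by linarith
  qed
  have term_le: "norm (p i ^ m * \<delta> i (n + m)) \<le> norm (p i) ^ m * (1 + norm (s i))" for i n m
    by (simp add: norm_mult norm_power mult_left_mono \<delta>_le)
  have geo_summable: "summable (\<lambda>m. norm (p i) ^ m * (1 + norm (s i)))" for i
    by (intro summable_mult2 summable_geometric) (use p_less[of i] in simp)
  have summable_norm_c: "summable (\<lambda>m. norm (p i ^ m * \<delta> i (n + m)))" for i n
    by (rule summable_comparison_test'[OF geo_summable[of i]]) (use term_le in simp)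
  then have summable_c: "summable (\<lambda>m. p i ^ m * \<delta> i (n + m))" for i n
    by (rule summable_norm_cancel)
  have c_0: "c 0 = 0"
  proof -
    have "(\<lambda>m. p i ^ m * \<delta> i m) sums (s i - s i)" for i
    proof -
      have "(\<lambda>m. p i ^ m * (s i * fps_nth 1 m)) sums s i"
        using sums_finite[of "{0}" "\<lambda>m. p i ^ m * (s i * fps_nth 1 m)"] by simp
      then show ?thesis
        unfolding \<delta>_def right_diff_distrib by (intro sums_diff spec[OF int])
    qed
    then show ?thesis
      by (simp add: c_def vec_eq_iff sums_iff)
  qed
  have c_rec: "c n $ i = p i * c (Suc n) $ i + fps_nth a n - s i * fps_nth 1 n" for n i
  proof -
    have "c n $ i = (\<Sum>m. p i ^ Suc m * \<delta> i (n + Suc m)) + \<delta> i n"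
      using suminf_split_head[OF summable_c[of i n]] by (simp add: c_def)
    also have "(\<Sum>m. p i ^ Suc m * \<delta> i (n + Suc m)) = p i * c (Suc n) $ i"
      using suminf_mult[OF summable_c[of i "Suc n"], of "p i"] by (simp add: c_def mult.assoc)
    finally show ?thesis
      by (simp add: \<delta>_def)
  qed
  define x where "x n = matrix_inv P *v c n" for n
  have Px: "P *v x n = c n" for n
    by (simp add: x_def P_matrix_inv)
  have c_le: "norm (c n $ i) \<le> (\<Sum>m. norm (p i) ^ m * (1 + norm (s i)))" for n i
    unfolding c_def vec_lambda_beta
    by (rule order_trans[OF summable_norm[OF summable_norm_c]]) (intro suminf_le term_le summable_norm_c geo_summable)
  obtain K where x_le: "\<And>n. norm (x n) \<le> K"
  proof -
    obtain B where B: "\<And>v. norm (matrix_inv P *v v) \<le> B * norm v"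
      using linear_bounded[OF linear_quat_matrix_vector[of "matrix_inv P"]] by blast
    define D where "D = (\<Sum>i\<in>(UNIV :: 'n set). \<Sum>m. norm (p i) ^ m * (1 + norm (s i)))"
    have c_D: "norm (c n) \<le> D" for n
    proof -
      have "(\<Sum>i\<in>UNIV. norm (c n $ i)) \<le> D"
        unfolding D_def by (rule sum_mono) (rule c_le)
      then show ?thesis
        using norm_vec_le_sum[of "c n"] by linarith
    qed
    have "norm (x n) \<le> \<bar>B\<bar> * D" for n
    proof -
      have "norm (x n) \<le> B * norm (c n)"
        unfolding x_def by (rule B)
      also have "\<dots> \<le> \<bar>B\<bar> * D"
        using c_D[of n] by (intro mult_mono) auto
      finally show ?thesis .
    qed
    then show ?thesis
      by (rule that)
  qed
  define d where "d n = back_input (x n - x (Suc n))" for n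
  define X where "X i = Abs_fps (\<lambda>n. x n $ i)" for i
  define b where "b i = Abs_fps (\<lambda>n. (x n - d n) $ i)" for i
  define u1 where "u1 = Abs_fps (\<lambda>n. fps_nth a n - out1 (d n))"
  define u2 where "u2 = Abs_fps (\<lambda>n. fps_nth 1 n - out2 (d n))"
  have cX: "coeff_vec X n = x n" for n
    by (simp add: coeff_vec_def X_def vec_eq_iff)
  have cb: "coeff_vec b n = x n - d n" for n
    by (simp add: coeff_vec_def b_def vec_eq_iff)
  have sys: "pick_system X b u1 u2 a 1"
  proof (rule pick_systemI)
    show "coeff_vec X 0 = 0"
      unfolding cX x_def c_0 by (simp add: matrix_vector_mult_def vec_eq_iff)
    fix n
    have "step (x n) (x n - d n) (x (Suc n)) (fps_nth a n - out1 (d n)) (fps_nth 1 n - out2 (d n))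
        (fps_nth a n) (fps_nth 1 n)"
      unfolding d_def by (rule step_of_back) (simp add: Px c_rec[of n])
    then show "step (coeff_vec X n) (coeff_vec b n) (coeff_vec X (Suc n)) (fps_nth u1 n) (fps_nth u2 n)
        (fps_nth a n) (fps_nth 1 n)"
      by (simp add: cX cb u1_def u2_def)
  qed
  \<comment> \<open>The balance equates the input difference with the state energy plus the output
    difference of a * g against g, which \<open>state_energy_le\<close> shows to be
    nonpositive.\<close>
  have contr: "(\<Sum>n<N. (norm (fps_nth (u1 * g) n))\<^sup>2) \<le> (\<Sum>n<N. (norm (fps_nth (u2 * g) n))\<^sup>2)" for g N
  proof -
    have "\<forall>n. norm (coeff_vec X n) \<le> K"
      by (simp add: cX x_le)
    from state_energy_le[OF sys a this, of g N]
    show ?thesis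
      using pick_system_energy[OF pick_system_mult[OF sys, of g], of N] by simp
  qed
  \<comment> \<open>Otherwise the contraction with g = 1 kills u_1 at time 0 as well. Zero inputs
    force b_0 = 0, and with x_0 = 0 the second output at time 0 would be 0 instead of 1.\<close>
  have "fps_nth u2 0 \<noteq> 0"
  proof
    assume u20: "fps_nth u2 0 = 0"
    then have "fps_nth u1 0 = 0"
      using contr[of 1 1] by simp
    then have st: "step 0 (coeff_vec b 0) (coeff_vec X 1) 0 0 (fps_nth a 0) 1"
      using pick_system_step[OF sys, of 0] pick_system_0[OF sys] u20 by simp
    then have "(1 - p i) * (P *v coeff_vec b 0) $ i = 0" for i
      by (simp add: step_def)
    then have "P *v coeff_vec b 0 = 0"
      using one_minus_p_nonzero by (simp add: vec_eq_iff)
    then have "coeff_vec b 0 = 0"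
      by (rule P_eq_0_imp)
    then show False
      using st by (simp add: step_def out2_def)
  qed
  then obtain v where v: "u2 * v = 1" "v * u2 = 1"
    by (rule fps_right_inverse_exists)
  define e where "e = u1 * v"
  have "schur_fps e"
    unfolding schur_fps_def
  proof (intro allI)
    fix h N
    have "u2 * (v * h) = h"
      using v by (simp flip: mult.assoc)
    then show "(\<Sum>n<N. (norm (fps_nth (e * h) n))\<^sup>2) \<le> (\<Sum>n<N. (norm (fps_nth h n))\<^sup>2)"
      using contr[of "v * h" N] by (simp add: e_def mult.assoc)
  qed
  moreover have "e * u2 = u1"
    using v by (simp add: e_def mult.assoc)
  \<comment> \<open>The inputs (u_1, u_2) = (e * u_2, u_2) also produce the outputs
    \<open>num e * u2\<close> and \<open>den e * u2\<close>; uniqueness matches these with a and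
    1.\<close>
  then obtain z y where "pick_system z y u1 u2 (num e * u2) (den e * u2)"
    using pick_system_num_den[of e u2] by metis
  from pick_system_unique[OF sys this] have "a = num e * u2" "den e * u2 = 1"
    by simp_all
  ultimately show ?thesis
    by blast
qed

end

text \<open>The first conjunct certifies that \<open>star_inv\<close> never takes its default value
  in the formula, so the quotient is a genuine star quotient. Functions are compared on the ball
  only, as their values elsewhere carry no meaning.\<close>

theorem theorem5p2:
  fixes p s :: "'n::finite \<Rightarrow> quat"
  assumes "\<forall>i. p i \<in> ball 0 1"
    and "inj p"
    and "pos_definite (pick_matrix p s)"
  shows
    "let \<Theta> = (\<lambda>a b q. Theta p s q $ a $ b);
         num = (\<lambda>\<E> q. (\<Theta> 1 1 \<star> \<E>) q + \<Theta> 1 2 q);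
         den = (\<lambda>\<E> q. (\<Theta> 2 1 \<star> \<E>) q + \<Theta> 2 2 q)
     in (\<forall>\<E>\<in>slice_schur. \<forall>q\<in>ball 0 1. star_inv_defined_at (den \<E>) q) \<and>
        (\<forall>S. S \<in> slice_schur \<and> (\<forall>i. S (p i) = s i) \<longleftrightarrow>
             (\<exists>\<E>\<in>slice_schur. \<forall>q\<in>ball 0 1. S q = (num \<E> \<star> star_inv (den \<E>)) q))"
proof -
  interpret pick_problem p s
    using assms by unfold_locales simp_all
  define \<Theta> where "\<Theta> = (\<lambda>a b q. Theta p s q $ a $ b)"
  define numf where "numf = (\<lambda>\<E> q. (\<Theta> 1 1 \<star> \<E>) q + \<Theta> 1 2 q)"
  define denf where "denf = (\<lambda>\<E> q. (\<Theta> 2 1 \<star> \<E>) q + \<Theta> 2 2 q)"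
  have \<Theta>: "has_qps (\<Theta> a b) (theta_fps a b)" for a b
    unfolding \<Theta>_def by (rule has_qps_Theta)
  have numf: "has_qps (numf \<E>) (num e)" and denf: "has_qps (denf \<E>) (den e)" if "has_qps \<E> e" for \<E> e
    unfolding numf_def denf_def num_def den_def by (intro has_qps_add has_qps_star_prod \<Theta> that)+
  have solution: "(\<forall>q\<in>ball 0 1. star_inv_defined_at (denf \<E>) q) \<and>
      schur_fps (num e * g) \<and> has_qps (numf \<E> \<star> star_inv (denf \<E>)) (num e * g) \<and>
      (\<forall>i. (\<lambda>m. p i ^ m * fps_nth (num e * g) m) sums s i)"
    if \<E>: "has_qps \<E> e" and e: "schur_fps e" and g': "den e * g = 1" for \<E> e g
  proof -
    obtain h where h: "den e * h = 1" "h * den e = 1" "qconv h" "schur_fps (num e * h)"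
      "\<forall>i. (\<lambda>m. p i ^ m * fps_nth (num e * h) m) sums s i"
      using parametrized_solution[OF e] by blast
    \<comment> \<open>The converse direction supplies g only as a right inverse of the denominator;
      it coincides with the convergent two-sided inverse h.\<close>
    have "g = h * den e * g"
      using h(2) by simp
    also have "\<dots> = h"
      by (simp add: mult.assoc g')
    finally have gh: "g = h" .
    note inv = star_inv_props[OF denf[OF \<E>] h(3) h(1)]
    show ?thesis
      unfolding gh using h(4,5) inv has_qps_star_prod[OF numf[OF \<E>] inv(2)] by simp
  qed
  have invertible: "\<forall>q\<in>ball 0 1. star_inv_defined_at (denf \<E>) q" if "\<E> \<in> slice_schur" for \<E>
  proof -
    obtain e where e: "has_qps \<E> e" "schur_fps e"
      using \<open>\<E> \<in> slice_schur\<close> by (auto simp: slice_schur_iff)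
    obtain g where "den e * g = 1"
      using parametrized_solution[OF e(2)] by blast
    from solution[OF e this] show ?thesis
      by blast
  qed
  have "S \<in> slice_schur \<and> (\<forall>i. S (p i) = s i)"
    if \<E>: "\<E> \<in> slice_schur" and S: "\<forall>q\<in>ball 0 1. S q = (numf \<E> \<star> star_inv (denf \<E>)) q" for S \<E>
  proof -
    obtain e where e: "has_qps \<E> e" "schur_fps e"
      using \<E> by (auto simp: slice_schur_iff)
    obtain g where "den e * g = 1"
      using parametrized_solution[OF e(2)] by blast
    note sol = solution[OF e this]
    have hS: "has_qps S (num e * g)"
      by (rule has_qps_cong[of "numf \<E> \<star> star_inv (denf \<E>)"]) (use sol S in auto)
    moreover have "S (p i) = s i" for i
    proof -
      have "(\<lambda>m. p i ^ m * fps_nth (num e * g) m) sums S (p i)"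
        using hS assms(1) by (simp add: has_qps_def)
      then show ?thesis
        using sol sums_unique2[of "\<lambda>m. p i ^ m * fps_nth (num e * g) m" "S (p i)" "s i"] by blast
    qed
    ultimately show ?thesis
      using sol by (auto simp: slice_schur_iff)
  qed
  moreover have "\<exists>\<E>\<in>slice_schur. \<forall>q\<in>ball 0 1. S q = (numf \<E> \<star> star_inv (denf \<E>)) q"
    if S: "S \<in> slice_schur" and int: "\<forall>i. S (p i) = s i" for S
  proof -
    obtain a where a: "has_qps S a" "schur_fps a"
      using S by (auto simp: slice_schur_iff)
    have "\<forall>i. (\<lambda>m. p i ^ m * fps_nth a m) sums s i"
    proof
      fix i
      have "(\<lambda>m. p i ^ m * fps_nth a m) sums S (p i)"
        using a(1) assms(1) by (simp add: has_qps_def)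
      then show "(\<lambda>m. p i ^ m * fps_nth a m) sums s i"
        by (simp add: int)
    qed
    then obtain e u where e: "schur_fps e" and u: "a = num e * u" "den e * u = 1"
      using solution_parameter[OF a(2)] by blast
    have \<E>: "has_qps (qeval e) e"
      by (rule has_qps_qeval[OF schur_fps_imp_qconv[OF e]])
    have "has_qps (numf (qeval e) \<star> star_inv (denf (qeval e))) a"
      using solution[OF \<E> e u(2)] u(1) by simp
    then have "\<forall>q\<in>ball 0 1. S q = (numf (qeval e) \<star> star_inv (denf (qeval e))) q"
      using has_qps_eq_qeval[OF a(1)] has_qps_eq_qeval[of _ a] by simp
    moreover have "qeval e \<in> slice_schur"
      using \<E> e by (auto simp: slice_schur_iff)
    ultimately show ?thesis
      by blast
  qed
  ultimately have "(\<forall>\<E>\<in>slice_schur. \<forall>q\<in>ball 0 1. star_inv_defined_at (denf \<E>) q) \<and>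
      (\<forall>S. S \<in> slice_schur \<and> (\<forall>i. S (p i) = s i) \<longleftrightarrow>
           (\<exists>\<E>\<in>slice_schur. \<forall>q\<in>ball 0 1. S q = (numf \<E> \<star> star_inv (denf \<E>)) q))"
    using invertible by blast
  then show ?thesis
    unfolding Let_def numf_def denf_def \<Theta>_def .
qed

end
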